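(* Let $\mathcal X$ be an RD-space, let $\rho$ be an admissible function on $\mathcal X$ and let $q\in[1,\infty)$. Then $\mathrm{BMO}_\rho(\mathcal X)=\mathrm{BMO}^q_\rho(\mathcal X)$ with equivalent norms, where $\mathrm{BMO}_\rho(\mathcal X)=\mathrm{BMO}^1_\rho(\mathcal X)$.
   Context: RD-space: $(\mathcal X,d)$ is a metric space with a regular Borel measure $\mu$ such that all balls $B(x,r)=\{y: d(x,y)<r\}$ have finite and positive measure; $\mu$ is doubling, i.e. there is $A_1\ge1$ with $\mu(B(x,2r))\le A_1\mu(B(x,r))$ for all $x\in\mathcal X$, $r>0$; and there are $0<\kappa\le n$, $A_2\in(0,1]$, $A_3\in[1,\infty)$ such that $A_2\lambda^\kappa\mu(B(x,r))\le\mu(B(x,\lambda r))\le A_3\lambda^n\mu(B(x,r))$ for all $x\in\mathcal X$, $0<r\le \mathrm{diam}(\mathcal X)/2$ and $1\le\lambda\le \mathrm{diam}(\mathcal X)/(2r)$. Balls are understood together with their center and radius. Admissible function: $\rho:\mathcal X\to(0,\infty)$ is admissible if there are positive constants $C_0,k_0$ such that $\frac1{\rho(x)}\le C_0\frac1{\rho(y)}\left(1+\frac{d(x,y)}{\rho(y)}\right)^{k_0}$ for all $x,y\in\mathcal X$. Let $\mathcal D$ be the collection of balls $B(x,r)$ with $r\ge\rho(x)$ and $f_B=\frac1{\mu(B)}\int_Bf\,d\mu$. For $q\in[1,\infty)$, $\mathrm{BMO}^q_\rho(\mathcal X)$ is the set of $f\in L^q_{\rm loc}(\mathcal X)$ ($|f|^q$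 integrable on every ball) with $$\|f\|_{\mathrm{BMO}^q_\rho(\mathcal X)}=\sup_{B\notin\mathcal D}\left\{\frac1{\mu(B)}\int_B|f-f_B|^q\,d\mu\right\}^{1/q}+\sup_{B\in\mathcal D}\left\{\frac1{\mu(B)}\int_B|f|^q\,d\mu\right\}^{1/q}<\infty.$$ *)

theory Defs
  imports "HOL-Analysis.Analysis"
begin

text \<open>The diameter of the space. The library constant \<^const>\<open>diameter\<close> is \<open>0\<close> on unbounded sets,
  whereas here an unbounded space must have infinite diameter.\<close>

definition ediam :: "'a::metric_space itself \<Rightarrow> ereal" where
  "ediam _ = (SUP (x, y) \<in> (UNIV :: ('a \<times> 'a) set). ereal (dist x y))"

text \<open>Regularity is Borel regularity, as usual in analysis on metric spaces. The \<open>\<sigma>\<close>-algebra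
  of \<open>\<mu>\<close> may be larger than the Borel one, so that completed measures are covered.\<close>

definition regular_borel_measure :: "'a::metric_space measure \<Rightarrow> bool" where
  "regular_borel_measure \<mu> \<longleftrightarrow>
     sets borel \<subseteq> sets \<mu> \<and>
     (\<forall>A \<in> sets \<mu>. \<exists>G \<in> sets borel. A \<subseteq> G \<and> emeasure \<mu> G = emeasure \<mu> A)"

definition rd_space :: "'a::metric_space measure \<Rightarrow> bool" where
  "rd_space \<mu> \<longleftrightarrow>
     regular_borel_measure \<mu> \<and>
     (\<forall>x r. 0 < r \<longrightarrow> 0 < emeasure \<mu> (ball x r) \<and> emeasure \<mu> (ball x r) < \<infinity>) \<and>
     (\<exists>A1 \<ge> 1. \<forall>x r. 0 < r \<longrightarrow> measure \<mu> (ball x (2 * r)) \<le> A1 * measure \<mu> (ball x r)) \<and>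
     (\<exists>\<kappa> n A2 A3. 0 < \<kappa> \<and> \<kappa> \<le> n \<and> 0 < A2 \<and> A2 \<le> 1 \<and> 1 \<le> A3 \<and>
        (\<forall>x r l. 0 < r \<and> ereal r \<le> ediam TYPE('a) / 2 \<and>
                 1 \<le> l \<and> ereal l \<le> ediam TYPE('a) / ereal (2 * r) \<longrightarrow>
           A2 * l powr \<kappa> * measure \<mu> (ball x r) \<le> measure \<mu> (ball x (l * r)) \<and>
           measure \<mu> (ball x (l * r)) \<le> A3 * l powr n * measure \<mu> (ball x r)))"

definition admissible :: "('a::metric_space \<Rightarrow> real) \<Rightarrow> bool" where
  "admissible \<rho> \<longleftrightarrow>
     (\<forall>x. 0 < \<rho> x) \<and>
     (\<exists>C0 > 0. \<exists>k0 > 0. \<forall>x y.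
        1 / \<rho> x \<le> C0 * (1 / \<rho> y) * (1 + dist x y / \<rho> y) powr k0)"

text \<open>Balls are identified with pairs of a center and a (positive) radius, so the collection
  \<open>\<D>\<close> and its complement are sets of such pairs.\<close>

definition D_balls :: "('a::metric_space \<Rightarrow> real) \<Rightarrow> ('a \<times> real) set" where
  "D_balls \<rho> = {(x, r). 0 < r \<and> \<rho> x \<le> r}"

definition non_D_balls :: "('a::metric_space \<Rightarrow> real) \<Rightarrow> ('a \<times> real) set" where
  "non_D_balls \<rho> = {(x, r). 0 < r} - D_balls \<rho>"

definition avg :: "'a::metric_space measure \<Rightarrow> 'a set \<Rightarrow> ('a \<Rightarrow> 'b) \<Rightarrow> 'b::{banach, second_countable_topology}" where
  "avg \<mu> B f = (1 / measure \<mu> B) *\<^sub>R (LINT y:B|\<mu>. f y)"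

definition Lq_loc :: "'a::metric_space measure \<Rightarrow> real \<Rightarrow> ('a \<Rightarrow> complex) set" where
  "Lq_loc \<mu> q = {f \<in> borel_measurable \<mu>.
     \<forall>x r. 0 < r \<longrightarrow> set_integrable \<mu> (ball x r) (\<lambda>y. norm (f y) powr q)}"

text \<open>The value is meaningful for \<open>f \<in> Lq_loc \<mu> q\<close>, where all the integrals exist; it lies in
  \<^typ>\<open>ennreal\<close> because the suprema may be infinite.\<close>

definition bmo_norm ::
  "'a::metric_space measure \<Rightarrow> ('a \<Rightarrow> real) \<Rightarrow> real \<Rightarrow> ('a \<Rightarrow> complex) \<Rightarrow> ennreal" where
  "bmo_norm \<mu> \<rho> q f =
     (SUP (x, r) \<in> non_D_balls \<rho>.
        ennreal (avg \<mu> (ball x r) (\<lambda>y. norm (f y - avg \<mu> (ball x r) f) powr q) powr (1 / q))) +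
     (SUP (x, r) \<in> D_balls \<rho>.
        ennreal (avg \<mu> (ball x r) (\<lambda>y. norm (f y) powr q) powr (1 / q)))"

definition BMO ::
  "'a::metric_space measure \<Rightarrow> ('a \<Rightarrow> real) \<Rightarrow> real \<Rightarrow> ('a \<Rightarrow> complex) set" where
  "BMO \<mu> \<rho> q = {f \<in> Lq_loc \<mu> q. bmo_norm \<mu> \<rho> q f < \<infinity>}"

end

theory Submission
  imports Defs "HOL-Real_Asymp.Real_Asymp"
begin

text \<open>The inequality for the \<open>1\<close>-norm by the \<open>q\<close>-norm is Jensen's inequality on each ball
  (\<open>bmo_norm_1_le\<close>). The converse is the John--Nirenberg self-improvement. Balls in \<open>\<D>\<close>
  control the average of \<open>|f|\<close>, hence also its mean oscillation, so a function with
  \<open>\<parallel>f\<parallel> = N\<close> has mean oscillation at most \<open>2 * N\<close> over every ball (\<open>BMO_1_bounds\<close>). By the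
  John--Nirenberg inequality on a doubling space (\<open>john_nirenberg_level_sets\<close>), the sets where \<open>f\<close>
  differs from its mean by more than \<open>k * a\<close>, with \<open>a\<close> a multiple of \<open>N\<close>, have relative measure at
  most \<open>2\<^sup>-\<^sup>k\<close>; summing over the layers bounds the oscillation in \<open>L\<^sup>q\<close> by a multiple of
  \<open>N\<close> on all balls. On the balls in \<open>\<D>\<close> the mean is bounded by \<open>N\<close> as well, which bounds
  \<open>f\<close> itself.

  The John--Nirenberg inequality rests on a stopping-time decomposition (\<open>calderon_zygmund_balls\<close>):
  a ball is split into a part where all small averages of the oscillation stay below a height \<open>l\<close>,
  and balls on which the average is comparable to \<open>l\<close>, whose total measure is small if \<open>l\<close> is
  large. On the first
  part the oscillation is bounded almost everywhere by a differentiation argument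
  (\<open>null_if_averages_small\<close>); on each of the balls the estimate is repeated. Both steps
  select balls with the same greedy procedure (\<open>greedy_selection\<close>) and charge the measure
  of overlapping balls to disjoint smaller ones (\<open>emeasure_cover_le_disjoint\<close>), where the doubling
  constant enters.\<close>

section \<open>Selection of balls and disjoint families\<close>

text \<open>The selection step of the Vitali covering lemma, freed from its geometry: run through \<open>\<Omega>\<close> in
  a well-order that puts smaller ranks first, and keep a point unless it conflicts with one kept
  earlier. With large balls ranked first, a discarded ball meets a kept ball that is at least as
  large. With constant rank it yields maximal separated sets.\<close>

lemma greedy_selection:
  fixes \<Omega> :: "'a set" and rank :: "'a \<Rightarrow> nat" and conflict :: "'a \<Rightarrow> 'a \<Rightarrow> bool"
  assumes sym: "\<And>x y. conflict x y \<Longrightarrow> conflict y x"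
  obtains C where "C \<subseteq> \<Omega>"
    and "\<And>x y. x \<in> C \<Longrightarrow> y \<in> C \<Longrightarrow> x \<noteq> y \<Longrightarrow> \<not> conflict x y"
    and "\<And>y. y \<in> \<Omega> \<Longrightarrow> \<exists>c\<in>C. rank c \<le> rank y \<and> (c = y \<or> conflict y c)"
proof -
  obtain r :: "'a rel" where r: "Well_order r" "Field r = UNIV"
    using well_ordering by metis
  have wfr: "wf (r - Id)" using r(1) by (simp add: well_order_on_def)
  have "total_on UNIV r" using r by (simp add: well_order_on_def linear_order_on_def)
  then have tot: "x \<noteq> y \<Longrightarrow> (x, y) \<in> r \<or> (y, x) \<in> r" for x y
    by (auto simp: total_on_def)
  define W where "W = inv_image (less_than <*lex*> (r - Id)) (\<lambda>x. (rank x, x))"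
  have wfW: "wf W" unfolding W_def
    by (rule wf_inv_image[OF wf_lex_prod[OF wf_less_than wfr]])
  define F where "F = (\<lambda>sel y. y \<in> \<Omega> \<and> (\<forall>d. (d, y) \<in> W \<longrightarrow> sel d \<longrightarrow> \<not> conflict y d))"
  define sel where "sel = wfrec W F"
  have sel: "sel y \<longleftrightarrow> y \<in> \<Omega> \<and> (\<forall>d. (d, y) \<in> W \<longrightarrow> sel d \<longrightarrow> \<not> conflict y d)" for y
  proof -
    have "sel y = F (cut sel W y) y" unfolding sel_def by (rule wfrec[OF wfW])
    also have "\<dots> = F sel y"
      unfolding F_def by (intro conj_cong all_cong1 imp_cong refl) (simp add: cut_apply)
    finally show ?thesis by (simp add: F_def)
  qed
  show thesis
  proof
    show "Collect sel \<subseteq> \<Omega>"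
    proof
      fix y assume "y \<in> Collect sel"
      then show "y \<in> \<Omega>" using sel[of y] by simp
    qed
    show "\<not> conflict x y" if "x \<in> Collect sel" "y \<in> Collect sel" "x \<noteq> y" for x y
    proof -
      have "(x, y) \<in> W \<or> (y, x) \<in> W"
        using tot[of x y] that(3) by (auto simp: W_def in_inv_image)
      then show ?thesis
      proof
        assume "(x, y) \<in> W"
        then have "\<not> conflict y x" using that sel[of y] by simp
        then show ?thesis using sym by blast
      next
        assume "(y, x) \<in> W"
        then show ?thesis using that sel[of x] by simp
      qed
    qed
    show "\<exists>c\<in>Collect sel. rank c \<le> rank y \<and> (c = y \<or> conflict y c)" if "y \<in> \<Omega>" for y
    proof (cases "sel y")
      case False
      then have "\<exists>d. (d, y) \<in> W \<and> sel d \<and> conflict y d"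
        using sel[of y] that by simp
      then obtain d where d: "(d, y) \<in> W" "sel d" "conflict y d" by blast
      then have "rank d \<le> rank y" by (auto simp: W_def)
      then show ?thesis using d by blast
    qed auto
  qed
qed

text \<open>Only finitely many members can have measure above a given threshold, since together they fit
  into \<open>V\<close>. The measures of disjoint selected balls therefore add up.\<close>

lemma countable_disjoint_family_positive:
  assumes meas: "\<And>c. c \<in> C \<Longrightarrow> Y c \<in> sets M" and disj: "disjoint_family_on Y C"
    and sub: "\<And>c. c \<in> C \<Longrightarrow> Y c \<subseteq> V" and V: "V \<in> sets M" "emeasure M V < \<infinity>"
    and pos: "\<And>c. c \<in> C \<Longrightarrow> 0 < emeasure M (Y c)"
  shows "countable C"
proof -
  define D where "D n = {c \<in> C. inverse (real (Suc n)) < measure M (Y c)}" for n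
  have fin: "emeasure M (Y c) < \<infinity>" if "c \<in> C" for c
    using emeasure_mono[OF sub[OF that] V(1)] V(2) by (rule le_less_trans)
  have "finite (D n)" for n
  proof (rule ccontr)
    assume "infinite (D n)"
    obtain N :: nat where N: "real (Suc n) * measure M V < real N" using reals_Archimedean2 by blast
    obtain S where S: "finite S" "card S = N" "S \<subseteq> D n"
      using \<open>infinite (D n)\<close> infinite_arbitrarily_large by metis
    have SC: "S \<subseteq> C" using S(3) by (auto simp: D_def)
    have "real N * inverse (real (Suc n)) \<le> (\<Sum>c\<in>S. measure M (Y c))"
      using sum_mono[of S "\<lambda>_. inverse (real (Suc n))" "\<lambda>c. measure M (Y c)"] S
      by (auto simp: D_def less_imp_le subset_iff)
    also have "\<dots> = measure M (\<Union>c\<in>S. Y c)"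
      using SC S(1) disj meas fin
      by (intro measure_finite_Union[symmetric]) (auto simp: disjoint_family_on_def subset_iff less_top)
    also have "\<dots> \<le> measure M V"
      using SC S(1) sub V meas by (intro measure_mono_fmeasurable) (auto simp: fmeasurable_def intro!: sets.finite_UN)
    finally show False using N by (simp add: field_simps)
  qed
  moreover have "C \<subseteq> (\<Union>n. D n)"
  proof
    fix c assume c: "c \<in> C"
    then have "0 < measure M (Y c)" using pos[OF c] fin[OF c]
      by (simp add: measure_def enn2real_positive_iff)
    then show "c \<in> (\<Union>n. D n)" using reals_Archimedean c by (fastforce simp: D_def)
  qed
  ultimately show ?thesis
    by (meson countable_UN countable_finite countable_subset countableI_type)
qed

text \<open>Overlapping enlarged sets are charged to disjoint ones. In the applications one of the two
  measures is \<open>\<mu>\<close> and the other has a density with respect to \<open>\<mu>\<close>, so that bounds on averages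
  over single balls add up to a bound on the union.\<close>

lemma emeasure_cover_le_disjoint:
  assumes C: "countable C" and X: "\<And>c. c \<in> C \<Longrightarrow> X c \<in> sets N"
    and Y: "\<And>c. c \<in> C \<Longrightarrow> Y c \<in> sets M" "disjoint_family_on Y C"
    and le: "\<And>c. c \<in> C \<Longrightarrow> emeasure N (X c) \<le> K * emeasure M (Y c)"
  shows "emeasure N (\<Union>c\<in>C. X c) \<le> K * emeasure M (\<Union>c\<in>C. Y c)"
proof -
  define I where "I = to_nat_on C ` C"
  define e where "e = from_nat_into C"
  have eI: "e n \<in> C" "to_nat_on C (e n) = n" if "n \<in> I" for n
    using that C by (auto simp: I_def e_def)
  have eC: "C = e ` I" using C by (auto simp: I_def e_def image_image)
  define X' where "X' n = (if n \<in> I then X (e n) else {})" for n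
  define Y' where "Y' n = (if n \<in> I then Y (e n) else {})" for n
  have UX: "(\<Union>c\<in>C. X c) = (\<Union>n. X' n)" by (auto simp: eC X'_def split: if_splits)
  have UY: "(\<Union>c\<in>C. Y c) = (\<Union>n. Y' n)" by (auto simp: eC Y'_def split: if_splits)
  have Y'_sets: "range Y' \<subseteq> sets M" using Y(1) eI(1) by (auto simp: Y'_def)
  have "disjoint_family Y'"
    unfolding disjoint_family_on_def
  proof (intro ballI impI)
    fix m n :: nat assume "m \<noteq> n"
    show "Y' m \<inter> Y' n = {}"
    proof (cases "m \<in> I \<and> n \<in> I")
      case True
      then have "e m \<noteq> e n" using eI \<open>m \<noteq> n\<close> by metis
      then show ?thesis using Y(2) True eI(1) by (auto simp: Y'_def disjoint_family_on_def)
    qed (auto simp: Y'_def)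
  qed
  note sumY = suminf_emeasure[OF Y'_sets this]
  have "emeasure N (\<Union>n. X' n) \<le> (\<Sum>n. emeasure N (X' n))"
    using X eI by (intro emeasure_subadditive_countably) (auto simp: X'_def)
  also have "\<dots> \<le> (\<Sum>n. K * emeasure M (Y' n))"
    using le eI by (intro suminf_le) (auto simp: X'_def Y'_def)
  also have "\<dots> = K * emeasure M (\<Union>n. Y' n)" by (simp add: sumY)
  finally show ?thesis by (simp add: UX UY)
qed

text \<open>Sets that can be squeezed between a closed and an open set form a \<open>\<sigma>\<close>-algebra, and it
  contains the closed sets because a closed set is the intersection of its open neighbourhoods.\<close>

lemma outer_regular_finite_borel:
  fixes M :: "'a::metric_space measure"
  assumes "finite_measure M" and borel: "sets borel \<subseteq> sets M"
    and "A \<in> sets borel" and "0 < e"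
  shows "\<exists>F U. closed F \<and> open U \<and> F \<subseteq> A \<and> A \<subseteq> U \<and> measure M (U - F) < e"
proof -
  interpret finite_measure M by fact
  have op: "U \<in> sets M" if "open U" for U using that borel by auto
  have cl: "F \<in> sets M" if "closed F" for F using that borel by auto
  have "A \<in> sigma_sets UNIV (Collect closed)"
    using \<open>A \<in> sets borel\<close> by (simp add: borel_eq_closed)
  then show ?thesis using \<open>0 < e\<close>
  proof (induction arbitrary: e)
    case (Basic A)
    then have A: "closed A" by simp
    show ?case
    proof (cases "A = {}")
      case True
      then show ?thesis using Basic by (intro exI[of _ "{}"]) auto
    next
      case False
      define U where "U n = {x. infdist x A < inverse (real (Suc n))}" for n
      have U: "open (U n)" for n unfolding U_def
        by (intro open_Collect_less continuous_intros)
      have "decseq U"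
      proof (rule decseq_SucI)
        fix n
        have "inverse (real (Suc (Suc n))) \<le> inverse (real (Suc n))" by (intro le_imp_inverse_le) auto
        then show "U (Suc n) \<subseteq> U n" unfolding U_def by (intro Collect_mono impI) linarith
      qed
      have INT: "(\<Inter>n. U n) = A"
      proof
        show "A \<subseteq> (\<Inter>n. U n)" by (auto simp: U_def)
        show "(\<Inter>n. U n) \<subseteq> A"
        proof
          fix x assume x: "x \<in> (\<Inter>n. U n)"
          have "infdist x A \<le> 0"
          proof (rule ccontr)
            assume "\<not> infdist x A \<le> 0"
            then obtain n where "inverse (real (Suc n)) < infdist x A" using reals_Archimedean[of "infdist x A"] by auto
            then show False using x by (auto simp: U_def dest: spec[of _ n])
          qed
          then show "x \<in> A" using A False in_closed_iff_infdist_zero infdist_nonneg[of x A] by (metis order_antisym)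
        qed
      qed
      have "(\<lambda>n. measure M (U n)) \<longlonglongrightarrow> measure M A"
        using finite_Lim_measure_decseq[of U] U op \<open>decseq U\<close> INT by (auto simp: image_subset_iff)
      then obtain n where n: "measure M (U n) < measure M A + e"
        using order_tendstoD(2)[of _ "measure M A" sequentially "measure M A + e"] Basic(2)
        by (auto simp: eventually_sequentially)
      have "A \<subseteq> U n" using INT by auto
      then show ?thesis using n U[of n] A op cl
        by (intro exI[of _ A] exI[of _ "U n"]) (auto simp: finite_measure_Diff)
    qed
  next
    case Empty
    then show ?case by (intro exI[of _ "{}"]) auto
  next
    case (Compl A)
    obtain F U where FU: "closed F" "open U" "F \<subseteq> A" "A \<subseteq> U" "measure M (U - F) < e"
      using Compl(2)[OF Compl(3)] by blast
    have "closed (- U)" "open (- F)" "- U \<subseteq> UNIV - A" "UNIV - A \<subseteq> - F"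
      using FU(1-4) by blast+
    moreover have "- F - (- U) = U - F" by auto
    ultimately show ?case using FU(5) by metis
  next
    case (Union A)
    have "\<exists>F U. closed F \<and> open U \<and> F \<subseteq> A n \<and> A n \<subseteq> U \<and> measure M (U - F) < (e/2) * (1/2) ^ Suc n" for n
      using Union(2)[of "(e/2) * (1/2) ^ Suc n" n] Union(3) by simp
    then obtain F U where FU: "\<And>n. closed (F n)" "\<And>n. open (U n)" "\<And>n. F n \<subseteq> A n"
      "\<And>n. A n \<subseteq> U n" "\<And>n. measure M (U n - F n) < (e/2) * (1/2) ^ Suc n"
      by metis
    have sm: "(\<lambda>n. (e/2) * (1/2) ^ Suc n) sums (e/2)"
      using sums_mult[OF power_half_series, of "e/2"] by simp
    have UF_sets: "U n - F n \<in> sets M" for n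
      by (rule sets.Diff[OF op[OF FU(2)] cl[OF FU(1)]])
    have smU: "summable (\<lambda>n. measure M (U n - F n))"
    proof (rule summable_comparison_test'[OF sums_summable[OF sm]])
      show "norm (measure M (U n - F n)) \<le> (e/2) * (1/2) ^ Suc n" for n
        using FU(5)[of n] by (simp only: real_norm_def abs_of_nonneg[OF measure_nonneg] less_imp_le)
    qed
    have "measure M (\<Union>n. U n - F n) \<le> (\<Sum>n. measure M (U n - F n))"
      by (intro finite_measure_subadditive_countably smU) (use UF_sets in auto)
    also have "\<dots> \<le> (\<Sum>n. (e/2) * (1/2) ^ Suc n)"
      using FU(5) by (intro suminf_le smU sums_summable[OF sm] less_imp_le)
    also have "\<dots> = e/2" using sums_unique[OF sm] by simp
    finally have 1: "measure M (\<Union>n. U n - F n) \<le> e/2" .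
    \<comment> \<open>The union of all \<open>F n\<close> need not be closed; a finite part of it is, and suffices by finiteness of \<open>M\<close>.\<close>
    define G where "G n = (\<Union>i\<le>n. F i)" for n
    have G: "closed (G n)" for n unfolding G_def using FU by auto
    have UG_sets: "(\<Union>n. U n) - G n \<in> sets M" for n
      using FU(2) G op cl by blast
    have "G m \<subseteq> G n" if "m \<le> n" for m n
      unfolding G_def using that by (intro UN_mono) auto
    then have "decseq (\<lambda>n. (\<Union>n. U n) - G n)" unfolding decseq_def by blast
    then have UG: "(\<lambda>n. measure M ((\<Union>n. U n) - G n)) \<longlonglongrightarrow> measure M (\<Inter>n. (\<Union>n. U n) - G n)"
      using UG_sets by (intro finite_Lim_measure_decseq) blast+
    have FG: "F n \<subseteq> G n" for n unfolding G_def by blast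
    have "(\<Inter>n. (\<Union>n. U n) - G n) \<subseteq> (\<Union>n. U n - F n)"
    proof
      fix x assume "x \<in> (\<Inter>n. (\<Union>n. U n) - G n)"
      then have "x \<in> (\<Union>n. U n)" "\<And>n. x \<notin> G n" by auto
      then show "x \<in> (\<Union>n. U n - F n)" using FG by blast
    qed
    moreover have "(\<Union>n. U n - F n) \<in> sets M"
      using UF_sets by (intro sets.countable_UN) auto
    ultimately have "measure M (\<Inter>n. (\<Union>n. U n) - G n) \<le> measure M (\<Union>n. U n - F n)"
      by (intro finite_measure_mono)
    then have "measure M (\<Inter>n. (\<Union>n. U n) - G n) < e" using 1 Union(3) by simp
    then obtain n where "measure M ((\<Union>n. U n) - G n) < e"
      using order_tendstoD(2)[OF UG] unfolding eventually_sequentially by blast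
    moreover have "G n \<subseteq> (\<Union>n. A n)" using FU(3) unfolding G_def by blast
    moreover have "(\<Union>n. A n) \<subseteq> (\<Union>n. U n)" using FU(4) by blast
    moreover have "open (\<Union>n. U n)" using FU(2) by blast
    ultimately show ?case using G[of n] by blast
  qed
qed

section \<open>Doubling measures and Calderon--Zygmund balls\<close>

text \<open>A ball of nonpositive radius is empty, so finiteness can be stated for every radius.\<close>

locale doubling_measure =
  fixes \<mu> :: "'a::metric_space measure" and A :: real
  assumes borel_sets: "sets borel \<subseteq> sets \<mu>"
    and borel_regular: "S \<in> sets \<mu> \<Longrightarrow> \<exists>G \<in> sets borel. S \<subseteq> G \<and> emeasure \<mu> G = emeasure \<mu> S"
    and ball_pos: "0 < r \<Longrightarrow> 0 < emeasure \<mu> (ball x r)"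
    and ball_finite: "emeasure \<mu> (ball x r) < \<infinity>"
    and A_ge_1: "1 \<le> A"
    and doubling: "0 < r \<Longrightarrow> emeasure \<mu> (ball x (2 * r)) \<le> ennreal A * emeasure \<mu> (ball x r)"
begin

lemma open_sets: "open U \<Longrightarrow> U \<in> sets \<mu>"
  using borel_sets by auto

lemma ball_sets [measurable, simp]: "ball x r \<in> sets \<mu>"
  by (simp add: open_sets)

lemma space_eq_UNIV [simp]: "space \<mu> = UNIV"
  using open_sets[OF open_UNIV] sets.sets_into_space by blast

text \<open>Borel regularity passes from a measurable set to a Borel set of the same measure; on the
  ball the measure is finite, so that set is enclosed in an open one.\<close>

lemma outer_regular:
  assumes S: "S \<in> sets \<mu>" "S \<subseteq> ball x0 R" and pos: "0 < emeasure \<mu> S"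
  obtains U where "open U" "S \<subseteq> U" "U \<subseteq> ball x0 R" "emeasure \<mu> U < 2 * emeasure \<mu> S"
proof -
  let ?B = "ball x0 R"
  define M where "M = density \<mu> (indicator ?B)"
  have eM: "emeasure M X = emeasure \<mu> (X \<inter> ?B)" if "X \<in> sets \<mu>" for X
    using that by (simp add: M_def emeasure_density indicator_inter_arith[symmetric]
        nn_integral_indicator Int_commute mult.commute)
  have M_sets: "sets M = sets \<mu>" by (simp add: M_def)
  interpret M: finite_measure M
  proof
    have "emeasure M (space M) = emeasure \<mu> (UNIV \<inter> ?B)"
      using eM[of UNIV] open_sets[OF open_UNIV] by (simp add: M_def)
    then show "emeasure M (space M) \<noteq> \<infinity>" using ball_finite[of x0 R] by simp
  qed
  obtain G where G: "G \<in> sets borel" "S \<subseteq> G" "emeasure \<mu> G = emeasure \<mu> S"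
    using borel_regular[OF S(1)] by blast
  have G\<mu>: "G \<in> sets \<mu>" using G(1) borel_sets by blast
  have "emeasure \<mu> (G \<inter> ?B) = emeasure \<mu> S"
  proof (rule antisym)
    show "emeasure \<mu> (G \<inter> ?B) \<le> emeasure \<mu> S"
      using emeasure_mono[of "G \<inter> ?B" G \<mu>] G\<mu> G(3) by auto
    show "emeasure \<mu> S \<le> emeasure \<mu> (G \<inter> ?B)"
      using G(2) S G\<mu> by (intro emeasure_mono) auto
  qed
  then have MG: "emeasure M G = emeasure \<mu> S" using eM[OF G\<mu>] by simp
  then have Gpos: "0 < measure M G"
    using pos by (metis M.emeasure_eq_measure ennreal_less_zero_iff)
  obtain F U where FU: "closed F" "open U" "F \<subseteq> G" "G \<subseteq> U" "measure M (U - F) < measure M G"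
    using outer_regular_finite_borel[OF M.finite_measure_axioms _ G(1) Gpos] borel_sets M_sets by auto
  have UM: "U \<in> sets M" "F \<in> sets M" using FU(1,2) open_sets borel_sets M_sets by auto
  have "measure M U = measure M (U - F) + measure M F"
    using M.finite_measure_Diff[OF UM] FU(3,4) by auto
  also have "\<dots> < measure M G + measure M G"
    using FU(3,5) G\<mu> M_sets M.finite_measure_mono[OF FU(3)] by auto
  finally have "measure M U < 2 * measure M G" by simp
  then have "emeasure M U < ennreal (2 * measure M G)"
    by (simp add: M.emeasure_eq_measure ennreal_less_iff)
  also have "\<dots> = 2 * emeasure \<mu> S"
    using MG by (simp add: M.emeasure_eq_measure ennreal_mult)
  finally have "emeasure \<mu> (U \<inter> ?B) < 2 * emeasure \<mu> S"
    using eM[of U] UM M_sets by simp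
  then show thesis using that[of "U \<inter> ?B"] FU(2,4) G(2) S(2) by auto
qed

text \<open>A weak form of Lebesgue's differentiation theorem: if all averages of \<open>g\<close> over small dyadic
  balls around a point are at most \<open>l\<close>, then almost surely \<open>g < 2 * A * l\<close> there. Losing the
  factor \<open>2 * A\<close> costs nothing later and makes the proof short. Enclose the exceptional set
  \<open>E\<close> in an open \<open>U\<close> of less than twice its measure. The points of \<open>E\<close> whose ball of a fixed radius
  stays inside \<open>U\<close> are covered by such balls around a maximal separated set, and the balls of half
  the radius are disjoint inside \<open>U\<close>; hence the integral of \<open>g\<close> over these points is at most
  \<open>A * l * \<mu>(U)\<close>, and so is \<open>2 * A * l * \<mu>(E)\<close> in the limit, which forces \<open>\<mu>(E) = 0\<close>.\<close>

lemma null_if_averages_small: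
  fixes g :: "'a \<Rightarrow> ennreal"
  assumes g [measurable]: "g \<in> borel_measurable \<mu>"
    and E: "E \<in> sets \<mu>" "E \<subseteq> ball x0 R" and "0 < l" "0 < r"
    and small: "\<And>x n. x \<in> E \<Longrightarrow> (\<integral>\<^sup>+y\<in>ball x (r / 2 ^ n). g y \<partial>\<mu>) \<le> ennreal l * emeasure \<mu> (ball x (r / 2 ^ n))"
    and large: "\<And>x. x \<in> E \<Longrightarrow> ennreal (2 * A * l) \<le> g x"
  shows "emeasure \<mu> E = 0"
proof (rule ccontr)
  assume "emeasure \<mu> E \<noteq> 0"
  then have pos: "0 < emeasure \<mu> E" by (simp add: zero_less_iff_neq_zero)
  obtain U where U: "open U" "E \<subseteq> U" "U \<subseteq> ball x0 R" "emeasure \<mu> U < 2 * emeasure \<mu> E"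
    using outer_regular[OF E pos] .
  have U_sets: "U \<in> sets \<mu>" by (rule open_sets[OF U(1)])
  have U_fin: "emeasure \<mu> U < \<infinity>"
    using emeasure_mono[OF U(3), of \<mu>] ball_finite[of x0 R] by (auto intro: le_less_trans)
  \<comment> \<open>The points of \<open>E\<close> at scale \<open>n\<close>; a single radius is then good for all of them.\<close>
  define D where "D n = {x \<in> E. ball x (r / 2 ^ n) \<subseteq> U}" for n :: nat
  have D_sets: "D n \<in> sets \<mu>" for n
  proof -
    have "D n = E - (\<Union>y\<in>-U. ball y (r / 2 ^ n))"
      by (auto simp: D_def subset_iff dist_commute)
    moreover have "(\<Union>y\<in>-U. ball y (r / 2 ^ n)) \<in> sets \<mu>" by (intro open_sets) auto
    ultimately show ?thesis using E(1) by simp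
  qed
  have D_bound: "ennreal (2 * A * l) * emeasure \<mu> (D n) \<le> ennreal (A * l) * emeasure \<mu> U" for n
  proof -
    let ?s = "r / 2 ^ n"
    have s: "0 < ?s" using \<open>0 < r\<close> by simp
    have half: "2 * (?s / 2) = ?s" by simp
    obtain C where C: "C \<subseteq> D n" "\<And>x y. x \<in> C \<Longrightarrow> y \<in> C \<Longrightarrow> x \<noteq> y \<Longrightarrow> \<not> dist x y < ?s"
      "\<And>y. y \<in> D n \<Longrightarrow> \<exists>c\<in>C. c = y \<or> dist y c < ?s"
      using greedy_selection[of "\<lambda>x y. dist x y < ?s" "D n" "\<lambda>_. 0"] by (auto simp: dist_commute)
    define Y where "Y c = ball c (?s / 2)" for c :: 'a
    have YU: "Y c \<subseteq> U" if "c \<in> C" for c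
    proof -
      have "ball c ?s \<subseteq> U" using C(1) that by (auto simp: D_def)
      moreover have "Y c \<subseteq> ball c ?s" unfolding Y_def using s by (intro subset_ball) simp
      ultimately show ?thesis by blast
    qed
    have disj: "disjoint_family_on Y C"
      unfolding disjoint_family_on_def
    proof (intro ballI impI)
      fix x y assume "x \<in> C" "y \<in> C" "x \<noteq> y"
      then have "?s \<le> dist x y" using C(2) by force
      then show "Y x \<inter> Y y = {}" unfolding Y_def by (intro disjoint_ballI) simp
    qed
    have "countable C"
      by (rule countable_disjoint_family_positive[of C Y \<mu> U])
         (use disj YU U_sets U_fin s in \<open>auto simp: Y_def intro!: ball_pos\<close>)
    moreover have "emeasure (density \<mu> g) (ball c ?s) \<le> ennreal (A * l) * emeasure \<mu> (Y c)" if "c \<in> C" for c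
    proof -
      have "c \<in> E" using that C(1) by (auto simp: D_def)
      have "emeasure (density \<mu> g) (ball c ?s) = (\<integral>\<^sup>+y\<in>ball c ?s. g y \<partial>\<mu>)"
        by (simp add: emeasure_density)
      also have "\<dots> \<le> ennreal l * emeasure \<mu> (ball c ?s)" by (rule small[OF \<open>c \<in> E\<close>])
      also have "\<dots> \<le> ennreal l * (ennreal A * emeasure \<mu> (Y c))"
        using doubling[of "?s / 2" c] s unfolding Y_def half by (intro mult_left_mono) auto
      also have "\<dots> = ennreal (A * l) * emeasure \<mu> (Y c)"
        using A_ge_1 \<open>0 < l\<close> by (simp add: ennreal_mult mult_ac)
      finally show ?thesis .
    qed
    ultimately have "emeasure (density \<mu> g) (\<Union>c\<in>C. ball c ?s) \<le> ennreal (A * l) * emeasure \<mu> (\<Union>c\<in>C. Y c)"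
      by (intro emeasure_cover_le_disjoint disj) (auto simp: Y_def)
    also have "\<dots> \<le> ennreal (A * l) * emeasure \<mu> U"
      using YU U_sets by (intro mult_left_mono emeasure_mono) auto
    finally have 1: "emeasure (density \<mu> g) (\<Union>c\<in>C. ball c ?s) \<le> ennreal (A * l) * emeasure \<mu> U" .
    have "ennreal (2 * A * l) * emeasure \<mu> (D n) = (\<integral>\<^sup>+y. ennreal (2 * A * l) * indicator (D n) y \<partial>\<mu>)"
      by (rule nn_integral_cmult_indicator[OF D_sets, symmetric])
    also have "\<dots> \<le> (\<integral>\<^sup>+y. g y * indicator (D n) y \<partial>\<mu>)"
      using large by (intro nn_integral_mono) (auto simp: D_def indicator_def)
    also have "\<dots> = emeasure (density \<mu> g) (D n)"
      using D_sets by (simp add: emeasure_density)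
    also have "\<dots> \<le> emeasure (density \<mu> g) (\<Union>c\<in>C. ball c ?s)"
    proof (rule emeasure_mono)
      show "D n \<subseteq> (\<Union>c\<in>C. ball c ?s)"
      proof
        fix y assume "y \<in> D n"
        then obtain c where "c \<in> C" "c = y \<or> dist y c < ?s" using C(3) by blast
        then show "y \<in> (\<Union>c\<in>C. ball c ?s)" using s by (force simp: dist_commute)
      qed
      show "(\<Union>c\<in>C. ball c ?s) \<in> sets (density \<mu> g)" by (auto intro: open_sets)
    qed
    finally show ?thesis using 1 by (rule order_trans)
  qed
  have "incseq D"
  proof (rule incseq_SucI)
    fix n
    have "ball x (r / 2 ^ Suc n) \<subseteq> ball x (r / 2 ^ n)" for x :: 'a
      using \<open>0 < r\<close> by (intro subset_ball) (simp add: field_simps)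
    then show "D n \<subseteq> D (Suc n)" unfolding D_def by blast
  qed
  have "(\<Union>n. D n) = E"
  proof
    show "E \<subseteq> (\<Union>n. D n)"
    proof
      fix x assume x: "x \<in> E"
      then obtain e where e: "0 < e" "ball x e \<subseteq> U" using U(1,2) by (meson openE subsetD)
      obtain n where "(1/2) ^ n < e / r"
        using real_arch_pow_inv[of "e / r" "1/2"] e \<open>0 < r\<close> by auto
      then have "r / 2 ^ n \<le> e" using \<open>0 < r\<close> by (simp add: field_simps power_divide)
      then have "ball x (r / 2 ^ n) \<subseteq> U" using e(2) subset_ball by blast
      then show "x \<in> (\<Union>n. D n)" using x by (auto simp: D_def)
    qed
  qed (auto simp: D_def)
  then have "emeasure \<mu> E = (SUP n. emeasure \<mu> (D n))"
    using SUP_emeasure_incseq[OF image_subsetI[OF D_sets] \<open>incseq D\<close>] by simp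
  then have "ennreal (2 * A * l) * emeasure \<mu> E = (SUP n. ennreal (2 * A * l) * emeasure \<mu> (D n))"
    by (simp add: SUP_mult_left_ennreal)
  also have "\<dots> \<le> ennreal (A * l) * emeasure \<mu> U" by (intro SUP_least D_bound)
  also have "\<dots> < ennreal (A * l) * (2 * emeasure \<mu> E)"
    using U(4) A_ge_1 \<open>0 < l\<close> by (intro ennreal_mult_strict_left_mono) (auto simp: less_top)
  also have "\<dots> = ennreal (2 * A * l) * emeasure \<mu> E"
    using A_ge_1 \<open>0 < l\<close> by (simp add: ennreal_mult mult_ac)
  finally show False by simp
qed

text \<open>A Calderon--Zygmund decomposition at height \<open>l\<close> without dyadic cubes. Around each point at
  which some dyadic average exceeds \<open>l\<close>, stop at the largest such radius \<open>s\<close>, and select disjoint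
  stopping balls, larger ones first. Since the average over \<open>ball x r\<close> is still small, the ball of
  radius \<open>2 * s\<close> has also been tested and passed, which gives the upper bound. The same doubled
  balls already contain every stopping point: it lies within \<open>s\<^sub>y + s\<^sub>c \<le> 2 * s\<^sub>c\<close> of
  a selected centre. At the remaining points all dyadic averages are small.\<close>

lemma calderon_zygmund_balls:
  fixes g :: "'a \<Rightarrow> ennreal"
  assumes g [measurable]: "g \<in> borel_measurable \<mu>" and "0 < r" "0 < l"
    and start: "\<And>x. x \<in> ball x0 r \<Longrightarrow> (\<integral>\<^sup>+y\<in>ball x r. g y \<partial>\<mu>) \<le> ennreal l * emeasure \<mu> (ball x r)"
  obtains C :: "'a set" and s :: "'a \<Rightarrow> real" where
    "countable C" "\<And>c. c \<in> C \<Longrightarrow> 0 < s c"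
    "disjoint_family_on (\<lambda>c. ball c (s c)) C" "\<And>c. c \<in> C \<Longrightarrow> ball c (s c) \<subseteq> ball x0 (2 * r)"
    "\<And>c. c \<in> C \<Longrightarrow> ennreal l * emeasure \<mu> (ball c (s c)) \<le> (\<integral>\<^sup>+y\<in>ball c (s c). g y \<partial>\<mu>)"
    "\<And>c. c \<in> C \<Longrightarrow> (\<integral>\<^sup>+y\<in>ball c (2 * s c). g y \<partial>\<mu>) \<le> ennreal l * emeasure \<mu> (ball c (2 * s c))"
    "emeasure \<mu> {y \<in> ball x0 r - (\<Union>c\<in>C. ball c (2 * s c)). ennreal (2 * A * l) \<le> g y} = 0"
proof -
  define bad where "bad x n \<longleftrightarrow> ennreal l * emeasure \<mu> (ball x (r / 2 ^ n)) < (\<integral>\<^sup>+y\<in>ball x (r / 2 ^ n). g y \<partial>\<mu>)"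
    for x and n :: nat
  define \<Omega> where "\<Omega> = {x \<in> ball x0 r. \<exists>n. bad x n}"
  \<comment> \<open>The stopping generation: the least bad one belongs to the largest bad ball.\<close>
  define k where "k x = (LEAST n. bad x n)" for x
  define s where "s x = r / 2 ^ k x" for x
  have s_pos: "0 < s x" for x using \<open>0 < r\<close> by (simp add: s_def)
  have s_mono: "s y \<le> s c" if "k c \<le> k y" for c y
    using that \<open>0 < r\<close> by (auto simp: s_def intro!: divide_left_mono power_increasing)
  have bad_k: "bad x (k x)" if "x \<in> \<Omega>" for x
    using that unfolding \<Omega>_def k_def by (auto intro: LeastI)
  \<comment> \<open>Generation \<open>0\<close> is excluded by the hypothesis on \<open>ball x r\<close>, so a stopping ball has a tested parent.\<close>
  have parent: "0 < k x \<and> 2 * s x = r / 2 ^ (k x - 1) \<and> \<not> bad x (k x - 1)" if "x \<in> \<Omega>" for x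
  proof -
    have "\<not> bad x 0" using start[of x] that by (auto simp: bad_def \<Omega>_def not_less)
    then have k: "0 < k x" using bad_k[OF that] by (cases "k x") auto
    then have "\<not> bad x (k x - 1)" unfolding k_def by (intro not_less_Least) auto
    moreover have "2 * s x = r / 2 ^ (k x - 1)" using k by (cases "k x") (auto simp: s_def)
    ultimately show ?thesis using k by blast
  qed
  have s_le: "s x \<le> r" for x using \<open>0 < r\<close> by (simp add: s_def divide_le_eq)
  have in2: "ball x (s x) \<subseteq> ball x0 (2 * r)" if "x \<in> ball x0 r" for x
  proof
    fix y assume "y \<in> ball x (s x)"
    then show "y \<in> ball x0 (2 * r)" using that s_le[of x] dist_triangle[of x0 y x] by auto
  qed
  obtain C where C: "C \<subseteq> \<Omega>"
    "\<And>x y. x \<in> C \<Longrightarrow> y \<in> C \<Longrightarrow> x \<noteq> y \<Longrightarrow> \<not> dist x y < s x + s y"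
    "\<And>y. y \<in> \<Omega> \<Longrightarrow> \<exists>c\<in>C. k c \<le> k y \<and> (c = y \<or> dist y c < s y + s c)"
    using greedy_selection[of "\<lambda>x y. dist x y < s x + s y" \<Omega> k] by (auto simp: dist_commute add.commute)
  have C0: "c \<in> ball x0 r" if "c \<in> C" for c using that C(1) by (auto simp: \<Omega>_def)
  have disj: "disjoint_family_on (\<lambda>c. ball c (s c)) C"
    unfolding disjoint_family_on_def
  proof (intro ballI impI)
    fix x y assume "x \<in> C" "y \<in> C" "x \<noteq> y"
    then have "s x + s y \<le> dist x y" using C(2) by force
    then show "ball x (s x) \<inter> ball y (s y) = {}" by (intro disjoint_ballI) simp
  qed
  have cover: "\<Omega> \<subseteq> (\<Union>c\<in>C. ball c (2 * s c))"
  proof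
    fix y assume "y \<in> \<Omega>"
    then obtain c where c: "c \<in> C" "k c \<le> k y" "c = y \<or> dist y c < s y + s c" using C(3) by blast
    then have "dist c y < 2 * s c" using s_mono[of c y] s_pos[of c] by (auto simp: dist_commute)
    then show "y \<in> (\<Union>c\<in>C. ball c (2 * s c))" using c(1) by auto
  qed
  show thesis
  proof (rule that[of C s])
    show "countable C"
      by (rule countable_disjoint_family_positive[OF _ disj, of \<mu> "ball x0 (2 * r)"])
         (use in2 C0 s_pos ball_finite in \<open>auto intro!: ball_pos\<close>)
    show "ennreal l * emeasure \<mu> (ball c (s c)) \<le> (\<integral>\<^sup>+y\<in>ball c (s c). g y \<partial>\<mu>)" if "c \<in> C" for c
      using bad_k[of c] C(1) that by (auto simp: bad_def s_def less_imp_le)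
    show "(\<integral>\<^sup>+y\<in>ball c (2 * s c). g y \<partial>\<mu>) \<le> ennreal l * emeasure \<mu> (ball c (2 * s c))" if "c \<in> C" for c
      using parent[of c] C(1) that by (auto simp: bad_def not_less)
    have UN: "(\<Union>c\<in>C. ball c (2 * s c)) \<in> sets \<mu>" by (auto intro: open_sets)
    show "emeasure \<mu> {y \<in> ball x0 r - (\<Union>c\<in>C. ball c (2 * s c)). ennreal (2 * A * l) \<le> g y} = 0"
    proof (rule null_if_averages_small[OF g _ _ \<open>0 < l\<close> \<open>0 < r\<close>])
      have "{y \<in> ball x0 r - (\<Union>c\<in>C. ball c (2 * s c)). ennreal (2 * A * l) \<le> g y}
          = (ball x0 r - (\<Union>c\<in>C. ball c (2 * s c))) \<inter> {y \<in> space \<mu>. ennreal (2 * A * l) \<le> g y}" by auto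
      also have "\<dots> \<in> sets \<mu>" using UN by (intro sets.Int sets.Diff ball_sets borel_measurable_le[OF borel_measurable_const g])
      finally show "{y \<in> ball x0 r - (\<Union>c\<in>C. ball c (2 * s c)). ennreal (2 * A * l) \<le> g y} \<in> sets \<mu>" .
      show "(\<integral>\<^sup>+y\<in>ball x (r / 2 ^ n). g y \<partial>\<mu>) \<le> ennreal l * emeasure \<mu> (ball x (r / 2 ^ n))"
        if "x \<in> {y \<in> ball x0 r - (\<Union>c\<in>C. ball c (2 * s c)). ennreal (2 * A * l) \<le> g y}" for x n
      proof -
        have "x \<notin> \<Omega>" using that cover by blast
        then have "\<not> bad x n" using that unfolding \<Omega>_def by blast
        then show ?thesis by (simp add: bad_def not_less)
      qed
    qed auto
  qed (use disj in2 C0 s_pos in auto)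
qed

end

section \<open>The John--Nirenberg inequality\<close>

context doubling_measure
begin

lemma norm_avg_diff_le:
  fixes f :: "'a \<Rightarrow> 'b::{banach, second_countable_topology}"
  assumes f: "set_integrable \<mu> (ball x r) f" and "0 < r" "0 \<le> l"
    and le: "(\<integral>\<^sup>+y\<in>ball x r. norm (f y - v) \<partial>\<mu>) \<le> ennreal l * emeasure \<mu> (ball x r)"
  shows "norm (avg \<mu> (ball x r) f - v) \<le> l"
proof -
  define P where "P = measure \<mu> (ball x r)"
  have eP: "emeasure \<mu> (ball x r) = ennreal P"
    using ball_finite[of x r] by (simp add: P_def emeasure_eq_ennreal_measure less_top)
  have P: "0 < P" using ball_pos[OF \<open>0 < r\<close>, of x] eP by simp
  have c: "set_integrable \<mu> (ball x r) (\<lambda>_. v)"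
    using ball_finite[of x r] by (auto simp: set_integrable_def intro!: integrable_scaleR_left integrable_real_indicator)
  have d: "set_integrable \<mu> (ball x r) (\<lambda>y. f y - v)" by (rule set_integral_diff(1)[OF f c])
  have v: "(LINT y:ball x r|\<mu>. v) = P *\<^sub>R v"
    using ball_finite[of x r] by (simp add: set_lebesgue_integral_def P_def)
  have "ennreal (norm (LINT y:ball x r|\<mu>. f y - v)) \<le> (\<integral>\<^sup>+y. norm (indicator (ball x r) y *\<^sub>R (f y - v)) \<partial>\<mu>)"
    using d unfolding set_integrable_def set_lebesgue_integral_def by (rule integral_norm_bound_ennreal)
  also have "\<dots> = (\<integral>\<^sup>+y\<in>ball x r. norm (f y - v) \<partial>\<mu>)"
    by (intro nn_integral_cong) (auto simp: indicator_def)
  also have "\<dots> \<le> ennreal (l * P)" using le \<open>0 \<le> l\<close> P by (simp add: eP ennreal_mult)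
  finally have "norm (LINT y:ball x r|\<mu>. f y - v) \<le> l * P" using \<open>0 \<le> l\<close> P by simp
  moreover have "avg \<mu> (ball x r) f - v = (1 / P) *\<^sub>R (LINT y:ball x r|\<mu>. f y - v)"
    using P by (simp add: avg_def P_def[symmetric] set_integral_diff(2)[OF f c] v scaleR_diff_right)
  ultimately show ?thesis using P by (simp add: divide_le_eq)
qed

text \<open>The John--Nirenberg inequality: the level sets of the oscillation decay geometrically, at
  the same rate on every ball, which is why the induction on \<open>k\<close> can be applied to the balls of a
  decomposition. Decompose \<open>g = |f - m2|\<close>, with \<open>m2\<close> the mean over the doubled ball, at height
  \<open>l = 2 * A\<^sup>2 * M\<close>. Outside the selected balls \<open>g < 2 * A * l\<close> almost surely, and on a
  selected ball, taken with doubled radius, the mean of \<open>f\<close> differs from \<open>m2\<close> by at most \<open>l\<close>. Hence where \<open>f\<close> differs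
  from its mean by more than \<open>(k + 1) * a\<close> with \<open>a = 3 * A * l\<close>, it differs from the mean over a selected
  ball by more than \<open>k * a\<close>, apart from a null set. As \<open>l\<close> is large compared with \<open>M\<close>, the
  selected doubled balls carry at most half the measure of the original ball.\<close>

lemma john_nirenberg_level_sets:
  fixes f :: "'a \<Rightarrow> 'b::{banach, second_countable_topology}"
  assumes f [measurable]: "f \<in> borel_measurable \<mu>"
    and int: "\<And>x r. 0 < r \<Longrightarrow> set_integrable \<mu> (ball x r) f"
    and osc: "\<And>x r. 0 < r \<Longrightarrow>
      (\<integral>\<^sup>+y\<in>ball x r. norm (f y - avg \<mu> (ball x r) f) \<partial>\<mu>) \<le> ennreal M * emeasure \<mu> (ball x r)"
    and "0 < M" and "0 < r"
  shows "emeasure \<mu> {y \<in> ball x r. real k * (6 * A ^ 3 * M) < norm (f y - avg \<mu> (ball x r) f)}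
    \<le> ennreal ((1/2) ^ k) * emeasure \<mu> (ball x r)"
  using \<open>0 < r\<close>
proof (induction k arbitrary: x r)
  case 0
  then show ?case by (auto intro!: emeasure_mono)
next
  case (Suc k)
  define l where "l = 2 * A\<^sup>2 * M"
  have A: "0 < A" "1 \<le> A" using A_ge_1 by auto
  have l: "0 < l" using A \<open>0 < M\<close> by (simp add: l_def)
  \<comment> \<open>A step of \<open>3 * A * l\<close> covers \<open>2 * A * l\<close> plus one change of mean off the selected balls, and two changes of mean on them.\<close>
  have al: "6 * A ^ 3 * M = 3 * A * l" by (simp add: l_def power3_eq_cube power2_eq_square)
  define m2 where "m2 = avg \<mu> (ball x (2 * r)) f"
  define g where "g y = ennreal (norm (f y - m2))" for y
  have g [measurable]: "g \<in> borel_measurable \<mu>" unfolding g_def by measurable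
  have r2: "0 < 2 * r" using \<open>0 < r\<close> by simp
  have osc2: "(\<integral>\<^sup>+y\<in>ball x (2 * r). g y \<partial>\<mu>) \<le> ennreal M * emeasure \<mu> (ball x (2 * r))"
    unfolding g_def m2_def by (rule osc[OF r2])
  have mono: "(\<integral>\<^sup>+y\<in>S. g y \<partial>\<mu>) \<le> (\<integral>\<^sup>+y\<in>T. g y \<partial>\<mu>)" if "S \<subseteq> T" for S T
    using that by (intro nn_integral_mono) (auto simp: indicator_def)
  have start: "(\<integral>\<^sup>+y\<in>ball z r. g y \<partial>\<mu>) \<le> ennreal l * emeasure \<mu> (ball z r)" if z: "z \<in> ball x r" for z
  proof -
    have s1: "ball z r \<subseteq> ball x (2 * r)"
    proof
      fix y assume "y \<in> ball z r"
      then show "y \<in> ball x (2 * r)" using z dist_triangle[of x y z] by auto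
    qed
    have s2: "ball x (2 * r) \<subseteq> ball z (2 * (2 * r))"
    proof
      fix y assume "y \<in> ball x (2 * r)"
      then show "y \<in> ball z (2 * (2 * r))" using z dist_triangle[of z y x] \<open>0 < r\<close> by (auto simp: dist_commute)
    qed
    have "(\<integral>\<^sup>+y\<in>ball z r. g y \<partial>\<mu>) \<le> ennreal M * emeasure \<mu> (ball x (2 * r))"
      using mono[OF s1] osc2 by (rule order_trans)
    also have "\<dots> \<le> ennreal M * emeasure \<mu> (ball z (2 * (2 * r)))"
      by (intro mult_left_mono emeasure_mono s2) auto
    also have "\<dots> \<le> ennreal M * (ennreal A * emeasure \<mu> (ball z (2 * r)))"
      by (intro mult_left_mono doubling r2) auto
    also have "\<dots> \<le> ennreal M * (ennreal A * (ennreal A * emeasure \<mu> (ball z r)))"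
      by (intro mult_left_mono doubling \<open>0 < r\<close>) auto
    also have "\<dots> = ennreal (M * A * A) * emeasure \<mu> (ball z r)"
      using A \<open>0 < M\<close> by (simp add: ennreal_mult mult_ac)
    also have "\<dots> \<le> ennreal l * emeasure \<mu> (ball z r)"
      using A \<open>0 < M\<close> by (intro mult_right_mono ennreal_leI) (auto simp: l_def power2_eq_square)
    finally show ?thesis .
  qed
  obtain C s where CZ: "countable C" "\<And>c. c \<in> C \<Longrightarrow> 0 < s c"
    "disjoint_family_on (\<lambda>c. ball c (s c)) C" "\<And>c. c \<in> C \<Longrightarrow> ball c (s c) \<subseteq> ball x (2 * r)"
    "\<And>c. c \<in> C \<Longrightarrow> ennreal l * emeasure \<mu> (ball c (s c)) \<le> (\<integral>\<^sup>+y\<in>ball c (s c). g y \<partial>\<mu>)"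
    "\<And>c. c \<in> C \<Longrightarrow> (\<integral>\<^sup>+y\<in>ball c (2 * s c). g y \<partial>\<mu>) \<le> ennreal l * emeasure \<mu> (ball c (2 * s c))"
    "emeasure \<mu> {y \<in> ball x r - (\<Union>c\<in>C. ball c (2 * s c)). ennreal (2 * A * l) \<le> g y} = 0"
    by (rule calderon_zygmund_balls[OF g \<open>0 < r\<close> l start]) blast+
  define m where "m = avg \<mu> (ball x r) f"
  have m: "norm (m - m2) \<le> l"
    unfolding m_def
  proof (rule norm_avg_diff_le[OF int[OF \<open>0 < r\<close>] \<open>0 < r\<close>])
    show "(\<integral>\<^sup>+y\<in>ball x r. norm (f y - m2) \<partial>\<mu>) \<le> ennreal l * emeasure \<mu> (ball x r)"
      using start[of x] \<open>0 < r\<close> by (simp add: g_def)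
  qed (use l in simp)
  define Z where "Z = {y \<in> ball x r - (\<Union>c\<in>C. ball c (2 * s c)). ennreal (2 * A * l) \<le> g y}"
  define X where "X c = {y \<in> ball c (2 * s c). real k * (6 * A ^ 3 * M) < norm (f y - avg \<mu> (ball c (2 * s c)) f)}" for c
  have level_sets: "{y \<in> ball z t. a < norm (f y - v)} \<in> sets \<mu>" for z t a v
  proof -
    have "{y \<in> ball z t. a < norm (f y - v)} = ball z t \<inter> {y \<in> space \<mu>. a < norm (f y - v)}" by auto
    also have "\<dots> \<in> sets \<mu>" by (intro sets.Int ball_sets) measurable
    finally show ?thesis .
  qed
  have X_sets: "X c \<in> sets \<mu>" for c unfolding X_def by (rule level_sets)
  have UX_sets: "(\<Union>c\<in>C. X c) \<in> sets \<mu>" using CZ(1) X_sets by auto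
  have Z_sets: "Z \<in> sets \<mu>"
  proof -
    have "Z = (ball x r - (\<Union>c\<in>C. ball c (2 * s c))) \<inter> {y \<in> space \<mu>. ennreal (2 * A * l) \<le> g y}"
      by (auto simp: Z_def)
    also have "\<dots> \<in> sets \<mu>"
      using CZ(1) by (intro sets.Int sets.Diff ball_sets sets.countable_UN'' borel_measurable_le[OF borel_measurable_const g])
    finally show ?thesis .
  qed
  let ?S = "{y \<in> ball x r. real (Suc k) * (6 * A ^ 3 * M) < norm (f y - m)}"
  have sub: "?S \<subseteq> Z \<union> (\<Union>c\<in>C. X c)"
  proof
    fix y assume y: "y \<in> ?S"
    have tri: "norm (f y - m) \<le> norm (f y - m2) + norm (m - m2)"
      using norm_triangle_ineq4[of "f y - m2" "m - m2"] by simp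
    have gy: "real k * (6 * A ^ 3 * M) + 3 * A * l - l \<le> norm (f y - m2)"
    proof -
      have "real (Suc k) * (6 * A ^ 3 * M) = real k * (6 * A ^ 3 * M) + 3 * A * l"
        by (simp only: of_nat_Suc distrib_right mult_1 al)
      moreover have "real (Suc k) * (6 * A ^ 3 * M) < norm (f y - m)" using y by blast
      ultimately show ?thesis using m tri by linarith
    qed
    have Al: "l \<le> A * l" using A l by simp
    show "y \<in> Z \<union> (\<Union>c\<in>C. X c)"
    proof (cases "y \<in> (\<Union>c\<in>C. ball c (2 * s c))")
      case True
      then obtain c where c: "c \<in> C" "y \<in> ball c (2 * s c)" by blast
      let ?mc = "avg \<mu> (ball c (2 * s c)) f"
      have sc: "0 < 2 * s c" using CZ(2)[OF c(1)] by simp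
      have "norm (?mc - m2) \<le> l"
        using CZ(6)[OF c(1)] l by (intro norm_avg_diff_le[OF int[OF sc] sc]) (auto simp: g_def)
      moreover have "norm (f y - m2) \<le> norm (f y - ?mc) + norm (?mc - m2)"
        using norm_triangle_ineq[of "f y - ?mc" "?mc - m2"] by simp
      ultimately have "real k * (6 * A ^ 3 * M) < norm (f y - ?mc)"
        using gy Al l by linarith
      then show ?thesis using c by (auto simp: X_def)
    next
      case False
      have "0 \<le> real k * (6 * A ^ 3 * M)" using A \<open>0 < M\<close> by simp
      then have "2 * A * l \<le> norm (f y - m2)" using gy Al by linarith
      then have "ennreal (2 * A * l) \<le> g y" unfolding g_def by (rule ennreal_leI)
      then show ?thesis using False y by (auto simp: Z_def)
    qed
  qed
  \<comment> \<open>The induction hypothesis gives the power of two, passing to the disjoint balls \<open>A\<close>, and the stopping rule \<open>1 / l\<close>.\<close>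
  define K where "K = (1/2) ^ k * A / l"
  have K: "0 \<le> K" using A l by (simp add: K_def)
  have each: "emeasure \<mu> (X c) \<le> ennreal K * emeasure (density \<mu> g) (ball c (s c))" if c: "c \<in> C" for c
  proof -
    have sc: "0 < 2 * s c" using CZ(2)[OF c] by simp
    have "emeasure \<mu> (X c) \<le> ennreal ((1/2) ^ k) * emeasure \<mu> (ball c (2 * s c))"
      unfolding X_def by (rule Suc.IH[OF sc])
    also have "\<dots> \<le> ennreal ((1/2) ^ k) * (ennreal A * emeasure \<mu> (ball c (s c)))"
      by (intro mult_left_mono doubling CZ(2) c) auto
    also have "\<dots> = ennreal K * (ennreal l * emeasure \<mu> (ball c (s c)))"
    proof -
      have "ennreal K * ennreal l = ennreal ((1/2) ^ k) * ennreal A"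
        using A l K by (subst (1 2) ennreal_mult[symmetric]) (auto simp: K_def)
      then show ?thesis by (simp add: mult.assoc[symmetric])
    qed
    also have "\<dots> \<le> ennreal K * emeasure (density \<mu> g) (ball c (s c))"
      using CZ(5)[OF c] by (intro mult_left_mono) (auto simp: emeasure_density)
    finally show ?thesis .
  qed
  have "emeasure \<mu> ?S \<le> emeasure \<mu> (Z \<union> (\<Union>c\<in>C. X c))"
    using sub Z_sets UX_sets by (intro emeasure_mono) auto
  also have "\<dots> \<le> emeasure \<mu> Z + emeasure \<mu> (\<Union>c\<in>C. X c)"
    using Z_sets UX_sets by (rule emeasure_subadditive)
  also have "\<dots> = emeasure \<mu> (\<Union>c\<in>C. X c)" using CZ(7) by (simp add: Z_def)
  also have "\<dots> \<le> ennreal K * emeasure (density \<mu> g) (\<Union>c\<in>C. ball c (s c))"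
    using each X_sets by (intro emeasure_cover_le_disjoint CZ(1,3)) auto
  also have "\<dots> \<le> ennreal K * emeasure (density \<mu> g) (ball x (2 * r))"
    using CZ(4) by (intro mult_left_mono emeasure_mono) auto
  also have "\<dots> = ennreal K * (\<integral>\<^sup>+y\<in>ball x (2 * r). g y \<partial>\<mu>)" by (simp add: emeasure_density)
  also have "\<dots> \<le> ennreal K * (ennreal M * emeasure \<mu> (ball x (2 * r)))"
    by (intro mult_left_mono osc2) auto
  also have "\<dots> \<le> ennreal K * (ennreal M * (ennreal A * emeasure \<mu> (ball x r)))"
    by (intro mult_left_mono doubling \<open>0 < r\<close>) auto
  also have "\<dots> = ennreal (K * M * A) * emeasure \<mu> (ball x r)"
    using A K \<open>0 < M\<close> by (simp add: ennreal_mult mult_ac)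
  also have "K * M * A = (1/2) ^ Suc k"
    using A \<open>0 < M\<close> by (simp add: K_def l_def power2_eq_square)
  finally show ?case unfolding m_def .
qed

end

section \<open>Powers and averages\<close>

definition layer_const :: "real \<Rightarrow> real" where
  "layer_const q = (\<Sum>k. (real k + 1) powr q * (1/2) ^ k)"

lemma summable_layers: "summable (\<lambda>k. (real k + 1) powr q * (1/2) ^ k)"
proof (rule summable_comparison_test_bigo)
  show "summable (\<lambda>k. norm ((3/4::real) ^ k))" by simp
  show "(\<lambda>k. (real k + 1) powr q * (1/2) ^ k) \<in> O(\<lambda>k. (3/4) ^ k)" by real_asymp
qed

lemma layer_const_nonneg: "0 \<le> layer_const q"
  unfolding layer_const_def by (intro suminf_nonneg summable_layers) simp

text \<open>Geometric decay of level sets bounds every positive power: cut the range of \<open>h\<close> into layers of height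
  \<open>a\<close> and estimate \<open>h\<close> from above by the top of its layer.\<close>

lemma nn_integral_powr_le_of_level_sets:
  fixes h :: "'a \<Rightarrow> real"
  assumes h [measurable]: "h \<in> borel_measurable M" and B [measurable]: "B \<in> sets M" and "0 < a" "0 < q"
    and nonneg: "\<And>y. 0 \<le> h y"
    and level: "\<And>k. emeasure M {y \<in> B. real k * a < h y} \<le> ennreal ((1/2) ^ k) * emeasure M B"
  shows "(\<integral>\<^sup>+y\<in>B. ennreal (h y powr q) \<partial>M) \<le> ennreal (a powr q * layer_const q) * emeasure M B"
proof -
  define L where "L k = {y \<in> B. real k * a < h y}" for k :: nat
  define w where "w k = ((real k + 1) * a) powr q" for k :: nat
  have L: "L k \<in> sets M" for k
  proof -
    have "L k = B \<inter> {y \<in> space M. real k * a < h y}"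
      using sets.sets_into_space[OF B] by (auto simp: L_def)
    also have "\<dots> \<in> sets M" by measurable
    finally show ?thesis .
  qed
  have pointwise: "ennreal (h y powr q) * indicator B y \<le> (\<Sum>k. ennreal (w k) * indicator (L k) y)" for y
  proof (cases "y \<in> B \<and> 0 < h y")
    case True
    \<comment> \<open>The layer \<open>{k * a<..(k + 1) * a}\<close> that contains \<open>h y\<close>.\<close>
    define k where "k = nat (\<lceil>h y / a\<rceil> - 1)"
    have "0 < \<lceil>h y / a\<rceil>" using True \<open>0 < a\<close> by simp
    then have k: "real k = of_int \<lceil>h y / a\<rceil> - 1" by (simp add: k_def)
    have "real k < h y / a" "h y / a \<le> real k + 1" unfolding k by linarith+
    then have k2: "real k * a < h y" "h y \<le> (real k + 1) * a"
      using \<open>0 < a\<close> by (simp_all add: field_simps)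
    have "ennreal (h y powr q) * indicator B y \<le> ennreal (w k) * indicator (L k) y"
      using True k2 \<open>0 < q\<close> by (auto simp: w_def L_def intro!: ennreal_leI powr_mono2)
    also have "\<dots> \<le> (\<Sum>k. ennreal (w k) * indicator (L k) y)"
    proof -
      define F :: "nat \<Rightarrow> ennreal" where "F i = ennreal (w i) * indicator (L i) y" for i
      have "sum F {k} \<le> suminf F" by (intro sum_le_suminf) auto
      then have "F k \<le> suminf F" by simp
      then show ?thesis unfolding F_def .
    qed
    finally show ?thesis .
  next
    case False
    then have "ennreal (h y powr q) * indicator B y = 0"
      using nonneg[of y] by (auto simp: indicator_def)
    then show ?thesis by (simp only: zero_le)
  qed
  have "(\<integral>\<^sup>+y\<in>B. ennreal (h y powr q) \<partial>M) \<le> (\<integral>\<^sup>+y. (\<Sum>k. ennreal (w k) * indicator (L k) y) \<partial>M)"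
    by (intro nn_integral_mono pointwise)
  also have "\<dots> = (\<Sum>k. \<integral>\<^sup>+y. ennreal (w k) * indicator (L k) y \<partial>M)"
    using L by (intro nn_integral_suminf borel_measurable_times_ennreal borel_measurable_const
        borel_measurable_indicator)
  also have "\<dots> = (\<Sum>k. ennreal (w k) * emeasure M (L k))"
    by (intro suminf_cong nn_integral_cmult_indicator L)
  also have "\<dots> \<le> (\<Sum>k. ennreal (w k) * (ennreal ((1/2) ^ k) * emeasure M B))"
    using level by (intro suminf_le mult_left_mono) (auto simp: L_def)
  also have "\<dots> = (\<Sum>k. ennreal (a powr q * ((real k + 1) powr q * (1/2) ^ k)) * emeasure M B)"
    using \<open>0 < a\<close> by (intro suminf_cong) (simp add: w_def powr_mult ennreal_mult mult_ac)
  also have "\<dots> = (\<Sum>k. ennreal (a powr q * ((real k + 1) powr q * (1/2) ^ k))) * emeasure M B"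
    by simp
  also have "(\<Sum>k. ennreal (a powr q * ((real k + 1) powr q * (1/2) ^ k))) = ennreal (a powr q * layer_const q)"
    unfolding layer_const_def
    by (subst suminf_ennreal2) (auto intro!: summable_mult summable_layers simp: suminf_mult[OF summable_layers])
  finally show ?thesis .
qed

text \<open>The tangent of the concave function \<open>u \<mapsto> u powr (1 / q)\<close> at \<open>t powr q\<close>, evaluated at
  \<open>h powr q\<close>. Integrating it gives Jensen's inequality, and the integrability of \<open>h\<close> with it.\<close>

lemma young_tangent:
  fixes h t q :: real
  assumes "0 \<le> h" "0 < t" "1 \<le> q"
  shows "h \<le> t powr (1 - q) / q * h powr q + (1 - 1 / q) * t"
proof (cases "h = 0")
  case True
  then show ?thesis using assms by simp
next
  case False
  then have h: "0 < h" using assms by simp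
  have "((h / t) powr q) powr (1 / q) * 1 powr (1 - 1 / q) \<le> 1 / q * (h / t) powr q + (1 - 1 / q) * 1"
    using assms h by (intro Youngs_inequality_0) auto
  then have "h / t \<le> 1 / q * (h / t) powr q + (1 - 1 / q)"
    using assms h by (simp add: powr_powr)
  then have "h \<le> t * (1 / q * (h / t) powr q + (1 - 1 / q))"
    using assms by (simp add: divide_le_eq mult.commute)
  also have "\<dots> = t powr (1 - q) / q * h powr q + (1 - 1 / q) * t"
    using assms h by (simp add: powr_divide powr_diff field_simps)
  finally show ?thesis .
qed

lemma norm_powr_le_shift:
  fixes a b :: "'b::real_normed_vector"
  assumes "1 \<le> q"
  shows "norm a powr q \<le> 2 powr q * norm (a - b) powr q + 2 powr q * norm b powr q"
proof -
  let ?m = "max (norm (a - b)) (norm b)"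
  have "norm a \<le> 2 * ?m" using norm_triangle_ineq[of "a - b" b] by simp
  then have "norm a powr q \<le> (2 * ?m) powr q" using assms by (intro powr_mono2) auto
  also have "\<dots> = 2 powr q * ?m powr q" by (simp add: powr_mult)
  also have "?m powr q \<le> norm (a - b) powr q + norm b powr q" by (simp add: max_def)
  finally show ?thesis by (simp add: distrib_left)
qed

context doubling_measure
begin

text \<open>This lemma and the next translate between averages, which are meaningful only for integrable
  functions, and nonnegative integrals, which always exist.\<close>

lemma set_nn_integral_eq_avg:
  fixes h :: "'a \<Rightarrow> real"
  assumes h: "set_integrable \<mu> (ball x r) h" and nonneg: "\<And>y. 0 \<le> h y" and "0 < r"
  shows "(\<integral>\<^sup>+y\<in>ball x r. ennreal (h y) \<partial>\<mu>) = ennreal (avg \<mu> (ball x r) h) * emeasure \<mu> (ball x r)"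
    and "0 \<le> avg \<mu> (ball x r) h"
proof -
  let ?B = "ball x r"
  have e: "emeasure \<mu> ?B = ennreal (measure \<mu> ?B)"
    using ball_finite[of x r] by (simp add: emeasure_eq_ennreal_measure less_top)
  have P: "0 < measure \<mu> ?B" using ball_pos[OF \<open>0 < r\<close>, of x] e by simp
  have I: "0 \<le> (LINT y:?B|\<mu>. h y)"
    unfolding set_lebesgue_integral_def using nonneg by (intro integral_nonneg_AE) simp
  then show "0 \<le> avg \<mu> ?B h" unfolding avg_def by simp
  have "(\<integral>\<^sup>+y\<in>?B. ennreal (h y) \<partial>\<mu>) = (\<integral>\<^sup>+y. ennreal (indicator ?B y *\<^sub>R h y) \<partial>\<mu>)"
    by (intro nn_integral_cong) (auto simp: indicator_def)
  also have "\<dots> = ennreal (LINT y:?B|\<mu>. h y)"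
    unfolding set_lebesgue_integral_def using h nonneg
    by (intro nn_integral_eq_integral) (auto simp: set_integrable_def)
  also have "(LINT y:?B|\<mu>. h y) = avg \<mu> ?B h * measure \<mu> ?B"
    using P by (simp add: avg_def)
  also have "ennreal \<dots> = ennreal (avg \<mu> ?B h) * emeasure \<mu> ?B"
    using \<open>0 \<le> avg \<mu> ?B h\<close> by (simp add: e ennreal_mult)
  finally show "(\<integral>\<^sup>+y\<in>?B. ennreal (h y) \<partial>\<mu>) = ennreal (avg \<mu> ?B h) * emeasure \<mu> ?B" .
qed

lemma set_integrable_avg_le:
  fixes h :: "'a \<Rightarrow> real"
  assumes h [measurable]: "h \<in> borel_measurable \<mu>" and nonneg: "\<And>y. 0 \<le> h y" and "0 < r" "0 \<le> c"
    and le: "(\<integral>\<^sup>+y\<in>ball x r. ennreal (h y) \<partial>\<mu>) \<le> ennreal c * emeasure \<mu> (ball x r)"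
  shows "set_integrable \<mu> (ball x r) h" and "avg \<mu> (ball x r) h \<le> c"
proof -
  let ?B = "ball x r"
  have e: "emeasure \<mu> ?B = ennreal (measure \<mu> ?B)"
    using ball_finite[of x r] by (simp add: emeasure_eq_ennreal_measure less_top)
  have P: "0 < measure \<mu> ?B" using ball_pos[OF \<open>0 < r\<close>, of x] e by simp
  have "(\<integral>\<^sup>+y. ennreal (norm (indicator ?B y *\<^sub>R h y)) \<partial>\<mu>) = (\<integral>\<^sup>+y\<in>?B. ennreal (h y) \<partial>\<mu>)"
    using nonneg by (intro nn_integral_cong) (auto simp: indicator_def)
  also have "\<dots> < \<infinity>"
    using le by (rule le_less_trans) (simp add: e ennreal_mult_less_top)
  finally show int: "set_integrable \<mu> ?B h"
    unfolding set_integrable_def by (intro integrableI_bounded) auto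
  have "ennreal (avg \<mu> ?B h * measure \<mu> ?B) \<le> ennreal (c * measure \<mu> ?B)"
    using le set_nn_integral_eq_avg[OF int nonneg \<open>0 < r\<close>] \<open>0 \<le> c\<close> by (simp add: e ennreal_mult)
  then show "avg \<mu> ?B h \<le> c"
    using P \<open>0 \<le> c\<close> by simp
qed

lemma nn_integral_le_of_powr:
  fixes h :: "'a \<Rightarrow> real"
  assumes h [measurable]: "h \<in> borel_measurable \<mu>" and nonneg: "\<And>y. 0 \<le> h y" and "0 < t" "1 \<le> q"
    and le: "(\<integral>\<^sup>+y\<in>ball x r. ennreal (h y powr q) \<partial>\<mu>) \<le> ennreal (t powr q) * emeasure \<mu> (ball x r)"
  shows "(\<integral>\<^sup>+y\<in>ball x r. ennreal (h y) \<partial>\<mu>) \<le> ennreal t * emeasure \<mu> (ball x r)"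
proof -
  let ?B = "ball x r"
  define a where "a = t powr (1 - q) / q"
  define b where "b = (1 - 1 / q) * t"
  have ab: "0 \<le> a" "0 \<le> b" using \<open>0 < t\<close> \<open>1 \<le> q\<close> by (auto simp: a_def b_def)
  have "(\<integral>\<^sup>+y\<in>?B. ennreal (h y) \<partial>\<mu>)
      \<le> (\<integral>\<^sup>+y. ennreal a * (ennreal (h y powr q) * indicator ?B y) + ennreal b * indicator ?B y \<partial>\<mu>)"
  proof (intro nn_integral_mono)
    fix y
    have "ennreal (h y) \<le> ennreal (a * h y powr q + b)"
      unfolding a_def b_def by (intro ennreal_leI young_tangent nonneg \<open>0 < t\<close> \<open>1 \<le> q\<close>)
    also have "\<dots> = ennreal a * ennreal (h y powr q) + ennreal b" using ab by (simp add: ennreal_mult)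
    finally show "ennreal (h y) * indicator ?B y
        \<le> ennreal a * (ennreal (h y powr q) * indicator ?B y) + ennreal b * indicator ?B y"
      by (auto simp: indicator_def)
  qed
  also have "\<dots> = ennreal a * (\<integral>\<^sup>+y\<in>?B. ennreal (h y powr q) \<partial>\<mu>) + ennreal b * emeasure \<mu> ?B"
    by (subst nn_integral_add) (auto simp: nn_integral_cmult nn_integral_cmult_indicator)
  also have "\<dots> \<le> ennreal a * (ennreal (t powr q) * emeasure \<mu> ?B) + ennreal b * emeasure \<mu> ?B"
    by (intro add_right_mono mult_left_mono le) simp
  also have "\<dots> = ennreal (a * t powr q + b) * emeasure \<mu> ?B"
    using ab by (simp add: ennreal_mult distrib_right mult.assoc)
  also have "a * t powr q + b = t"
    using \<open>0 < t\<close> \<open>1 \<le> q\<close> by (simp add: a_def b_def powr_diff field_simps)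
  finally show ?thesis .
qed

text \<open>Both parts come from a bound for every \<open>t\<close> above the right-hand side, because the
  tangent needs \<open>t > 0\<close> while the right-hand side may vanish.\<close>

lemma avg_le_powr_avg:
  fixes h :: "'a \<Rightarrow> real"
  assumes h: "h \<in> borel_measurable \<mu>" and nonneg: "\<And>y. 0 \<le> h y" and "0 < r" "1 \<le> q"
    and int: "set_integrable \<mu> (ball x r) (\<lambda>y. h y powr q)"
  shows "set_integrable \<mu> (ball x r) h"
    and "avg \<mu> (ball x r) h \<le> avg \<mu> (ball x r) (\<lambda>y. h y powr q) powr (1 / q)"
proof -
  define J where "J = avg \<mu> (ball x r) (\<lambda>y. h y powr q)"
  have J: "0 \<le> J" unfolding J_def by (rule set_nn_integral_eq_avg(2)[OF int _ \<open>0 < r\<close>]) simp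
  have *: "(\<integral>\<^sup>+y\<in>ball x r. ennreal (h y) \<partial>\<mu>) \<le> ennreal t * emeasure \<mu> (ball x r)"
    if t: "J powr (1 / q) < t" for t
  proof (rule nn_integral_le_of_powr[OF h nonneg _ \<open>1 \<le> q\<close>])
    have t0: "0 \<le> J powr (1 / q)" by simp
    then show "0 < t" using t by linarith
    have "J = (J powr (1 / q)) powr q" using J \<open>1 \<le> q\<close> by (simp add: powr_powr)
    also have "\<dots> \<le> t powr q" using t \<open>1 \<le> q\<close> by (intro powr_mono2) auto
    finally show "(\<integral>\<^sup>+y\<in>ball x r. ennreal (h y powr q) \<partial>\<mu>) \<le> ennreal (t powr q) * emeasure \<mu> (ball x r)"
      using set_nn_integral_eq_avg(1)[OF int _ \<open>0 < r\<close>]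
      by (simp add: J_def[symmetric] mult_right_mono ennreal_leI)
  qed
  have pos: "0 \<le> t" if "J powr (1 / q) < t" for t
    using that powr_ge_zero[of J "1 / q"] by linarith
  show "set_integrable \<mu> (ball x r) h"
    using set_integrable_avg_le(1)[OF h nonneg \<open>0 < r\<close> pos *, of "J powr (1 / q) + 1"] by simp
  show "avg \<mu> (ball x r) h \<le> avg \<mu> (ball x r) (\<lambda>y. h y powr q) powr (1 / q)"
    unfolding J_def[symmetric]
  proof (rule dense_ge)
    fix t assume "J powr (1 / q) < t"
    then show "avg \<mu> (ball x r) h \<le> t"
      using set_integrable_avg_le(2)[OF h nonneg \<open>0 < r\<close> pos *] by blast
  qed
qed

lemma john_nirenberg_powr:
  fixes f :: "'a \<Rightarrow> 'b::{banach, second_countable_topology}"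
  assumes f [measurable]: "f \<in> borel_measurable \<mu>"
    and int: "\<And>x r. 0 < r \<Longrightarrow> set_integrable \<mu> (ball x r) f"
    and osc: "\<And>x r. 0 < r \<Longrightarrow>
      (\<integral>\<^sup>+y\<in>ball x r. norm (f y - avg \<mu> (ball x r) f) \<partial>\<mu>) \<le> ennreal M * emeasure \<mu> (ball x r)"
    and "0 < M" "0 < r" "0 < q"
  shows "(\<integral>\<^sup>+y\<in>ball x r. ennreal (norm (f y - avg \<mu> (ball x r) f) powr q) \<partial>\<mu>)
    \<le> ennreal ((6 * A ^ 3 * M) powr q * layer_const q) * emeasure \<mu> (ball x r)"
proof (rule nn_integral_powr_le_of_level_sets)
  show "0 < 6 * A ^ 3 * M" using A_ge_1 \<open>0 < M\<close> by simp
qed (use john_nirenberg_level_sets[OF f int osc \<open>0 < M\<close> \<open>0 < r\<close>] \<open>0 < q\<close> in auto)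

lemma nn_integral_norm_powr_shift:
  fixes f :: "'a \<Rightarrow> 'b::{banach, second_countable_topology}"
  assumes f [measurable]: "f \<in> borel_measurable \<mu>" and "1 \<le> q" "0 \<le> c"
    and le: "(\<integral>\<^sup>+y\<in>ball x r. ennreal (norm (f y - v) powr q) \<partial>\<mu>) \<le> ennreal c * emeasure \<mu> (ball x r)"
  shows "(\<integral>\<^sup>+y\<in>ball x r. ennreal (norm (f y) powr q) \<partial>\<mu>)
    \<le> ennreal (2 powr q * (c + norm v powr q)) * emeasure \<mu> (ball x r)"
proof -
  let ?B = "ball x r"
  have "(\<integral>\<^sup>+y\<in>?B. ennreal (norm (f y) powr q) \<partial>\<mu>)
      \<le> (\<integral>\<^sup>+y. ennreal (2 powr q) * (ennreal (norm (f y - v) powr q) * indicator ?B y)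
            + ennreal (2 powr q * norm v powr q) * indicator ?B y \<partial>\<mu>)"
  proof (intro nn_integral_mono)
    fix y
    have "ennreal (norm (f y) powr q) \<le> ennreal (2 powr q * norm (f y - v) powr q + 2 powr q * norm v powr q)"
      by (intro ennreal_leI norm_powr_le_shift \<open>1 \<le> q\<close>)
    also have "\<dots> = ennreal (2 powr q) * ennreal (norm (f y - v) powr q) + ennreal (2 powr q * norm v powr q)"
      by (simp add: ennreal_mult)
    finally show "ennreal (norm (f y) powr q) * indicator ?B y
        \<le> ennreal (2 powr q) * (ennreal (norm (f y - v) powr q) * indicator ?B y)
            + ennreal (2 powr q * norm v powr q) * indicator ?B y"
      by (auto simp: indicator_def)
  qed
  also have "\<dots> = ennreal (2 powr q) * (\<integral>\<^sup>+y\<in>?B. ennreal (norm (f y - v) powr q) \<partial>\<mu>)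
      + ennreal (2 powr q * norm v powr q) * emeasure \<mu> ?B"
    by (subst nn_integral_add) (auto simp: nn_integral_cmult nn_integral_cmult_indicator)
  also have "\<dots> \<le> ennreal (2 powr q) * (ennreal c * emeasure \<mu> ?B) + ennreal (2 powr q * norm v powr q) * emeasure \<mu> ?B"
    by (intro add_right_mono mult_left_mono le) simp
  also have "\<dots> = ennreal (2 powr q * (c + norm v powr q)) * emeasure \<mu> ?B"
    using \<open>0 \<le> c\<close> by (simp add: ennreal_mult distrib_left distrib_right mult.assoc)
  finally show ?thesis .
qed

section \<open>Comparison of the BMO norms\<close>

lemma Lq_loc_measurable: "f \<in> Lq_loc \<mu> q \<Longrightarrow> f \<in> borel_measurable \<mu>"
  by (simp add: Lq_loc_def)

lemma Lq_loc_diff: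
  assumes f: "f \<in> Lq_loc \<mu> q" and "1 \<le> q" "0 < r"
  shows "set_integrable \<mu> (ball x r) (\<lambda>y. norm (f y - v) powr q)"
proof -
  note [measurable] = Lq_loc_measurable[OF f]
  have int: "set_integrable \<mu> (ball x r) (\<lambda>y. norm (f y) powr q)"
    using f \<open>0 < r\<close> by (simp add: Lq_loc_def)
  let ?c = "avg \<mu> (ball x r) (\<lambda>y. norm (f y) powr q)"
  have c: "0 \<le> ?c" "(\<integral>\<^sup>+y\<in>ball x r. ennreal (norm (f y) powr q) \<partial>\<mu>) = ennreal ?c * emeasure \<mu> (ball x r)"
    using set_nn_integral_eq_avg[OF int _ \<open>0 < r\<close>] by simp_all
  have "(\<integral>\<^sup>+y\<in>ball x r. ennreal (norm (f y - v) powr q) \<partial>\<mu>)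
      \<le> ennreal (2 powr q * (?c + norm (- v) powr q)) * emeasure \<mu> (ball x r)"
    using c by (intro nn_integral_norm_powr_shift[OF _ \<open>1 \<le> q\<close>]) auto
  then show ?thesis using c by (intro set_integrable_avg_le(1)[OF _ _ \<open>0 < r\<close>]) auto
qed

lemma Lq_loc_subset_L1_loc:
  assumes f: "f \<in> Lq_loc \<mu> q" and "1 \<le> q"
  shows "f \<in> Lq_loc \<mu> 1"
proof -
  note [measurable] = Lq_loc_measurable[OF f]
  have "set_integrable \<mu> (ball x r) (\<lambda>y. norm (f y))" if "0 < r" for x r
    using f that by (intro avg_le_powr_avg(1)[OF _ _ that \<open>1 \<le> q\<close>, of "\<lambda>y. norm (f y)"]) (auto simp: Lq_loc_def)
  then show ?thesis using Lq_loc_measurable[OF f] by (simp add: Lq_loc_def)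
qed

text \<open>Jensen's inequality, ball by ball.\<close>

lemma bmo_norm_1_le:
  assumes f: "f \<in> Lq_loc \<mu> q" and "1 \<le> q"
  shows "bmo_norm \<mu> \<rho> 1 f \<le> bmo_norm \<mu> \<rho> q f"
proof -
  note [measurable] = Lq_loc_measurable[OF f]
  have le: "avg \<mu> (ball x r) (\<lambda>y. norm (f y - v) powr 1) powr (1 / 1)
      \<le> avg \<mu> (ball x r) (\<lambda>y. norm (f y - v) powr q) powr (1 / q)" if "0 < r" for x r v
  proof -
    have int: "set_integrable \<mu> (ball x r) (\<lambda>y. norm (f y - v) powr q)"
      by (rule Lq_loc_diff[OF f \<open>1 \<le> q\<close> that])
    have "set_integrable \<mu> (ball x r) (\<lambda>y. norm (f y - v))"
      by (rule avg_le_powr_avg(1)[OF _ _ that \<open>1 \<le> q\<close> int]) auto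
    then have "0 \<le> avg \<mu> (ball x r) (\<lambda>y. norm (f y - v))"
      by (rule set_nn_integral_eq_avg(2)[OF _ _ that]) simp
    moreover have "avg \<mu> (ball x r) (\<lambda>y. norm (f y - v))
      \<le> avg \<mu> (ball x r) (\<lambda>y. norm (f y - v) powr q) powr (1 / q)"
      by (rule avg_le_powr_avg(2)[OF _ _ that \<open>1 \<le> q\<close> int]) auto
    ultimately show ?thesis by simp
  qed
  show ?thesis
    unfolding bmo_norm_def
  proof (intro add_mono SUP_mono)
    show "\<exists>m\<in>non_D_balls \<rho>. (case n of (x, r) \<Rightarrow> ennreal (avg \<mu> (ball x r) (\<lambda>y. norm (f y - avg \<mu> (ball x r) f) powr 1) powr (1 / 1)))
       \<le> (case m of (x, r) \<Rightarrow> ennreal (avg \<mu> (ball x r) (\<lambda>y. norm (f y - avg \<mu> (ball x r) f) powr q) powr (1 / q)))"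
      if "n \<in> non_D_balls \<rho>" for n
      using that le by (intro bexI[of _ n]) (auto simp: non_D_balls_def intro!: ennreal_leI)
    show "\<exists>m\<in>D_balls \<rho>. (case n of (x, r) \<Rightarrow> ennreal (avg \<mu> (ball x r) (\<lambda>y. norm (f y) powr 1) powr (1 / 1)))
       \<le> (case m of (x, r) \<Rightarrow> ennreal (avg \<mu> (ball x r) (\<lambda>y. norm (f y) powr q) powr (1 / q)))"
      if "n \<in> D_balls \<rho>" for n
      using that le[of _ _ 0] by (intro bexI[of _ n]) (auto simp: D_balls_def intro!: ennreal_leI)
  qed
qed

text \<open>Chosen such that \<open>(bmo_const q * M) powr q\<close> bounds the average of \<open>|f| powr q\<close> over a ball when
  \<open>M\<close> bounds the mean oscillation over all balls and the mean over this ball is at most \<open>M\<close> in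
  norm: the John--Nirenberg bound for the oscillation plus \<open>M powr q\<close> for the mean, times the \<open>2 powr q\<close> lost in separating the two.\<close>

definition bmo_const :: "real \<Rightarrow> real" where
  "bmo_const q = (2 powr q * ((6 * A ^ 3) powr q * layer_const q + 1)) powr (1 / q)"

lemma bmo_const_pos: "0 < bmo_const q"
proof -
  have "0 < (6 * A ^ 3) powr q * layer_const q + 1" using layer_const_nonneg[of q] by (intro add_nonneg_pos) auto
  then show ?thesis by (simp add: bmo_const_def)
qed

text \<open>A function in \<open>BMO\<close> has bounded mean oscillation over all balls: over the balls in \<open>\<D>\<close>
  the oscillation is at most twice the average of \<open>|f|\<close>. These balls also have bounded means.\<close>

lemma BMO_1_bounds:
  assumes f: "f \<in> BMO \<mu> \<rho> 1"
  defines "N \<equiv> enn2real (bmo_norm \<mu> \<rho> 1 f)"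
  shows "0 < r \<Longrightarrow> set_integrable \<mu> (ball x r) f"
    and "(x, r) \<in> D_balls \<rho> \<Longrightarrow> norm (avg \<mu> (ball x r) f) \<le> N"
    and "0 < r \<Longrightarrow> (\<integral>\<^sup>+y\<in>ball x r. norm (f y - avg \<mu> (ball x r) f) \<partial>\<mu>) \<le> ennreal (2 * N) * emeasure \<mu> (ball x r)"
proof -
  have fL: "f \<in> Lq_loc \<mu> 1" using f by (simp add: BMO_def)
  note [measurable] = Lq_loc_measurable[OF fL]
  have N: "bmo_norm \<mu> \<rho> 1 f = ennreal N" "0 \<le> N" using f by (auto simp: BMO_def N_def)
  show int: "set_integrable \<mu> (ball x r) f" if "0 < r" for x r
  proof -
    have "set_integrable \<mu> (ball x r) (\<lambda>y. norm (f y))" using fL that by (simp add: Lq_loc_def)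
    then have "integrable \<mu> (\<lambda>y. norm (indicator (ball x r) y *\<^sub>R f y))"
      by (simp add: set_integrable_def abs_mult)
    then show ?thesis unfolding set_integrable_def by (subst (asm) integrable_norm_iff) measurable
  qed
  have bound: "(\<integral>\<^sup>+y\<in>ball x r. ennreal (norm (f y - v)) \<partial>\<mu>) \<le> ennreal N * emeasure \<mu> (ball x r)"
    if "0 < r" "ennreal (avg \<mu> (ball x r) (\<lambda>y. norm (f y - v) powr 1) powr (1 / 1)) \<le> bmo_norm \<mu> \<rho> 1 f" for x r v
  proof -
    have i: "set_integrable \<mu> (ball x r) (\<lambda>y. norm (f y - v))"
      using Lq_loc_diff[OF fL _ that(1), of x v] by simp
    note e = set_nn_integral_eq_avg[OF i _ that(1)]
    have "avg \<mu> (ball x r) (\<lambda>y. norm (f y - v)) \<le> N"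
      using that(2) e(2) N by simp
    then show ?thesis unfolding e(1)[OF norm_ge_zero] by (intro mult_right_mono ennreal_leI) auto
  qed
  have nonD: "(\<integral>\<^sup>+y\<in>ball x r. ennreal (norm (f y - avg \<mu> (ball x r) f)) \<partial>\<mu>) \<le> ennreal N * emeasure \<mu> (ball x r)"
    if "(x, r) \<in> non_D_balls \<rho>" for x r
  proof (rule bound)
    show "0 < r" using that by (simp add: non_D_balls_def)
    have "ennreal (avg \<mu> (ball x r) (\<lambda>y. norm (f y - avg \<mu> (ball x r) f) powr 1) powr (1 / 1))
      \<le> (SUP (x, r) \<in> non_D_balls \<rho>. ennreal (avg \<mu> (ball x r) (\<lambda>y. norm (f y - avg \<mu> (ball x r) f) powr 1) powr (1 / 1)))"
      using that by (intro SUP_upper2[of "(x, r)"]) auto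
    also have "\<dots> \<le> bmo_norm \<mu> \<rho> 1 f" unfolding bmo_norm_def by simp
    finally show "ennreal (avg \<mu> (ball x r) (\<lambda>y. norm (f y - avg \<mu> (ball x r) f) powr 1) powr (1 / 1)) \<le> bmo_norm \<mu> \<rho> 1 f" .
  qed
  have D: "(\<integral>\<^sup>+y\<in>ball x r. ennreal (norm (f y - 0)) \<partial>\<mu>) \<le> ennreal N * emeasure \<mu> (ball x r)"
    if "(x, r) \<in> D_balls \<rho>" for x r
  proof (rule bound)
    show "0 < r" using that by (simp add: D_balls_def)
    have "ennreal (avg \<mu> (ball x r) (\<lambda>y. norm (f y - 0) powr 1) powr (1 / 1))
      \<le> (SUP (x, r) \<in> D_balls \<rho>. ennreal (avg \<mu> (ball x r) (\<lambda>y. norm (f y) powr 1) powr (1 / 1)))"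
      using that by (intro SUP_upper2[of "(x, r)"]) auto
    also have "\<dots> \<le> bmo_norm \<mu> \<rho> 1 f" unfolding bmo_norm_def by simp
    finally show "ennreal (avg \<mu> (ball x r) (\<lambda>y. norm (f y - 0) powr 1) powr (1 / 1)) \<le> bmo_norm \<mu> \<rho> 1 f" .
  qed
  show mean: "norm (avg \<mu> (ball x r) f) \<le> N" if "(x, r) \<in> D_balls \<rho>" for x r
  proof -
    have r: "0 < r" using that by (simp add: D_balls_def)
    show ?thesis using norm_avg_diff_le[OF int[OF r] r N(2) D[OF that]] by simp
  qed
  show "(\<integral>\<^sup>+y\<in>ball x r. norm (f y - avg \<mu> (ball x r) f) \<partial>\<mu>) \<le> ennreal (2 * N) * emeasure \<mu> (ball x r)"
    if r: "0 < r"
  proof (cases "(x, r) \<in> D_balls \<rho>")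
    case True
    let ?m = "avg \<mu> (ball x r) f"
    have "(\<integral>\<^sup>+y\<in>ball x r. norm (f y - ?m) \<partial>\<mu>)
        \<le> (\<integral>\<^sup>+y. ennreal (norm (f y - 0)) * indicator (ball x r) y + ennreal N * indicator (ball x r) y \<partial>\<mu>)"
    proof (intro nn_integral_mono)
      fix y
      have "norm (f y - ?m) \<le> norm (f y - 0) + N"
        using norm_triangle_ineq4[of "f y" ?m] mean[OF True] by simp
      then have "ennreal (norm (f y - ?m)) \<le> ennreal (norm (f y - 0) + N)" by (rule ennreal_leI)
      also have "\<dots> = ennreal (norm (f y - 0)) + ennreal N" by (rule ennreal_plus[OF norm_ge_zero N(2)])
      finally have "ennreal (norm (f y - ?m)) \<le> ennreal (norm (f y - 0)) + ennreal N" .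
      then show "ennreal (norm (f y - ?m)) * indicator (ball x r) y
        \<le> ennreal (norm (f y - 0)) * indicator (ball x r) y + ennreal N * indicator (ball x r) y"
        by (auto simp: indicator_def)
    qed
    also have "\<dots> = (\<integral>\<^sup>+y\<in>ball x r. ennreal (norm (f y - 0)) \<partial>\<mu>) + ennreal N * emeasure \<mu> (ball x r)"
      by (subst nn_integral_add) (auto simp: nn_integral_cmult_indicator)
    also have "\<dots> \<le> ennreal N * emeasure \<mu> (ball x r) + ennreal N * emeasure \<mu> (ball x r)"
      by (intro add_right_mono D True)
    also have "\<dots> = ennreal (2 * N) * emeasure \<mu> (ball x r)"
      by (simp only: mult_2 ennreal_plus[OF N(2) N(2)] distrib_right)
    finally show ?thesis .
  next
    case False
    then have "(x, r) \<in> non_D_balls \<rho>" using r by (simp add: non_D_balls_def)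
    from nonD[OF this] show ?thesis
      by (rule order_trans) (use N(2) in \<open>auto intro!: mult_right_mono ennreal_leI\<close>)
  qed
qed

text \<open>The John--Nirenberg inequality bounds the oscillation in \<open>L\<^sup>q\<close> over all balls; on a ball
  in \<open>\<D>\<close> the bounded mean then controls \<open>f\<close> itself. The level-set estimate needs a positive
  oscillation bound even when the norm of \<open>f\<close> is zero, hence a strict upper bound \<open>M\<close>.\<close>

lemma BMO_1_powr_bounds:
  assumes f: "f \<in> BMO \<mu> \<rho> 1" and "1 \<le> q" and M: "2 * enn2real (bmo_norm \<mu> \<rho> 1 f) < M"
  shows "f \<in> Lq_loc \<mu> q" and "bmo_norm \<mu> \<rho> q f \<le> ennreal (2 * bmo_const q * M)"
proof -
  note b = BMO_1_bounds[OF f]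
  have [measurable]: "f \<in> borel_measurable \<mu>" using f by (auto simp: BMO_def Lq_loc_def)
  have "0 \<le> enn2real (bmo_norm \<mu> \<rho> 1 f)" by simp
  then have M0: "0 < M" "enn2real (bmo_norm \<mu> \<rho> 1 f) \<le> M" using M by linarith+
  have osc: "(\<integral>\<^sup>+y\<in>ball x r. norm (f y - avg \<mu> (ball x r) f) \<partial>\<mu>) \<le> ennreal M * emeasure \<mu> (ball x r)"
    if "0 < r" for x r
    using b(3)[OF that] by (rule order_trans) (use M in \<open>auto intro!: mult_right_mono ennreal_leI\<close>)
  define c where "c = (6 * A ^ 3 * M) powr q * layer_const q"
  have c0: "0 \<le> c" unfolding c_def using layer_const_nonneg by simp
  have jn: "(\<integral>\<^sup>+y\<in>ball x r. ennreal (norm (f y - avg \<mu> (ball x r) f) powr q) \<partial>\<mu>) \<le> ennreal c * emeasure \<mu> (ball x r)"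
    if "0 < r" for x r
    unfolding c_def using b(1) osc that M0 \<open>1 \<le> q\<close> by (intro john_nirenberg_powr) auto
  note shift = nn_integral_norm_powr_shift[OF _ \<open>1 \<le> q\<close> c0 jn]
  show "f \<in> Lq_loc \<mu> q"
    unfolding Lq_loc_def
  proof (intro CollectI conjI allI impI)
    show "set_integrable \<mu> (ball x r) (\<lambda>y. norm (f y) powr q)" if "0 < r" for x r
    proof (rule set_integrable_avg_le(1)[OF _ _ that])
      show "(\<integral>\<^sup>+y\<in>ball x r. ennreal (norm (f y) powr q) \<partial>\<mu>)
        \<le> ennreal (2 powr q * (c + norm (avg \<mu> (ball x r) f) powr q)) * emeasure \<mu> (ball x r)"
        by (rule shift[OF _ that]) simp
    qed (use c0 in auto)
  qed simp
  have c: "2 powr q * (c + M powr q) = (bmo_const q * M) powr q"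
  proof -
    have "0 \<le> 2 powr q * ((6 * A ^ 3) powr q * layer_const q + 1)"
      using layer_const_nonneg[of q] by simp
    then have "bmo_const q powr q = 2 powr q * ((6 * A ^ 3) powr q * layer_const q + 1)"
      using \<open>1 \<le> q\<close> by (simp add: bmo_const_def powr_powr)
    then show ?thesis
      using M0 A_ge_1 by (simp add: c_def powr_mult algebra_simps)
  qed
  have root: "ennreal (a powr (1 / q)) \<le> ennreal (bmo_const q * M)" if "0 \<le> a" "a \<le> 2 powr q * (c + M powr q)" for a
  proof -
    have "a powr (1 / q) \<le> ((bmo_const q * M) powr q) powr (1 / q)"
      using that c \<open>1 \<le> q\<close> by (intro powr_mono2) auto
    also have "\<dots> = bmo_const q * M" using \<open>1 \<le> q\<close> M0 bmo_const_pos[of q] by (simp add: powr_powr)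
    finally show ?thesis by (rule ennreal_leI)
  qed
  have "(SUP (x, r) \<in> non_D_balls \<rho>. ennreal (avg \<mu> (ball x r) (\<lambda>y. norm (f y - avg \<mu> (ball x r) f) powr q) powr (1 / q)))
      \<le> ennreal (bmo_const q * M)"
  proof (rule SUP_least, clarify)
    fix x r assume "(x, r) \<in> non_D_balls \<rho>"
    then have r: "0 < r" by (simp add: non_D_balls_def)
    have i: "set_integrable \<mu> (ball x r) (\<lambda>y. norm (f y - avg \<mu> (ball x r) f) powr q)"
      "avg \<mu> (ball x r) (\<lambda>y. norm (f y - avg \<mu> (ball x r) f) powr q) \<le> c"
      using set_integrable_avg_le[OF _ _ r c0 jn[OF r, of x]] by simp_all
    have "1 \<le> 2 powr q" using \<open>1 \<le> q\<close> by (simp add: ge_one_powr_ge_zero)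
    then have "1 * c \<le> 2 powr q * (c + M powr q)" using c0 by (intro mult_mono) auto
    then show "ennreal (avg \<mu> (ball x r) (\<lambda>y. norm (f y - avg \<mu> (ball x r) f) powr q) powr (1 / q)) \<le> ennreal (bmo_const q * M)"
      using i set_nn_integral_eq_avg(2)[OF i(1) _ r] by (intro root) auto
  qed
  moreover have "(SUP (x, r) \<in> D_balls \<rho>. ennreal (avg \<mu> (ball x r) (\<lambda>y. norm (f y) powr q) powr (1 / q)))
      \<le> ennreal (bmo_const q * M)"
  proof (rule SUP_least, clarify)
    fix x r assume D: "(x, r) \<in> D_balls \<rho>"
    then have r: "0 < r" by (simp add: D_balls_def)
    let ?m = "avg \<mu> (ball x r) f"
    have c1: "0 \<le> 2 powr q * (c + norm ?m powr q)" using c0 by simp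
    have sh: "(\<integral>\<^sup>+y\<in>ball x r. ennreal (norm (f y) powr q) \<partial>\<mu>)
        \<le> ennreal (2 powr q * (c + norm ?m powr q)) * emeasure \<mu> (ball x r)" by (rule shift[OF _ r]) simp
    have i: "set_integrable \<mu> (ball x r) (\<lambda>y. norm (f y) powr q)"
      "avg \<mu> (ball x r) (\<lambda>y. norm (f y) powr q) \<le> 2 powr q * (c + norm ?m powr q)"
      using set_integrable_avg_le[OF _ _ r c1 sh] by simp_all
    have "norm ?m powr q \<le> M powr q"
      using b(2)[OF D] M0 \<open>1 \<le> q\<close> by (intro powr_mono2) auto
    then have "2 powr q * (c + norm ?m powr q) \<le> 2 powr q * (c + M powr q)" by simp
    with i(2) have "avg \<mu> (ball x r) (\<lambda>y. norm (f y) powr q) \<le> 2 powr q * (c + M powr q)"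
      by (rule order_trans)
    then show "ennreal (avg \<mu> (ball x r) (\<lambda>y. norm (f y) powr q) powr (1 / q)) \<le> ennreal (bmo_const q * M)"
      using i set_nn_integral_eq_avg(2)[OF i(1) _ r] by (intro root) auto
  qed
  ultimately have "bmo_norm \<mu> \<rho> q f \<le> ennreal (bmo_const q * M) + ennreal (bmo_const q * M)"
    unfolding bmo_norm_def by (rule add_mono)
  also have "\<dots> = ennreal (2 * bmo_const q * M)"
    using M0 bmo_const_pos[of q] by (simp add: ennreal_plus[symmetric] del: ennreal_plus)
  finally show "bmo_norm \<mu> \<rho> q f \<le> ennreal (2 * bmo_const q * M)" .
qed

lemma bmo_norm_le_bmo_norm_1:
  assumes f: "f \<in> BMO \<mu> \<rho> 1" and "1 \<le> q"
  shows "bmo_norm \<mu> \<rho> q f \<le> ennreal (4 * bmo_const q) * bmo_norm \<mu> \<rho> 1 f"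
proof (rule ennreal_le_epsilon)
  define N where "N = enn2real (bmo_norm \<mu> \<rho> 1 f)"
  have N: "bmo_norm \<mu> \<rho> 1 f = ennreal N" "0 \<le> N" using f by (auto simp: BMO_def N_def)
  fix e :: real assume "0 < e"
  \<comment> \<open>The excess of \<open>M\<close> over \<open>2 * N\<close> contributes exactly \<open>e\<close>.\<close>
  define M where "M = 2 * N + e / (2 * bmo_const q)"
  have "2 * N < M" using \<open>0 < e\<close> bmo_const_pos[of q] by (simp add: M_def)
  then have "bmo_norm \<mu> \<rho> q f \<le> ennreal (2 * bmo_const q * M)"
    using BMO_1_powr_bounds(2)[OF f \<open>1 \<le> q\<close>] by (simp add: N_def)
  also have "2 * bmo_const q * M = 4 * bmo_const q * N + e"
    using bmo_const_pos[of q] by (simp add: M_def distrib_left)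
  also have "ennreal \<dots> = ennreal (4 * bmo_const q) * bmo_norm \<mu> \<rho> 1 f + ennreal e"
    using N \<open>0 < e\<close> bmo_const_pos[of q] by (simp add: ennreal_mult)
  finally show "bmo_norm \<mu> \<rho> q f \<le> ennreal (4 * bmo_const q) * bmo_norm \<mu> \<rho> 1 f + ennreal e" .
qed

end

section \<open>Equivalence of the norms on an RD-space\<close>

lemma rd_space_imp_doubling_measure:
  assumes "rd_space \<mu>"
  obtains A where "doubling_measure \<mu> A"
proof -
  have reg: "regular_borel_measure \<mu>"
    and balls: "\<And>x r. 0 < r \<Longrightarrow> 0 < emeasure \<mu> (ball x r) \<and> emeasure \<mu> (ball x r) < \<infinity>"
    using assms by (auto simp: rd_space_def)
  obtain A where A: "1 \<le> A" "\<And>x r. 0 < r \<Longrightarrow> measure \<mu> (ball x (2 * r)) \<le> A * measure \<mu> (ball x r)"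
    using assms unfolding rd_space_def by blast
  have "doubling_measure \<mu> A"
  proof
    show "emeasure \<mu> (ball x r) < \<infinity>" for x r
      using balls[of r x] by (cases "0 < r") (auto simp: ball_empty)
    show "emeasure \<mu> (ball x (2 * r)) \<le> ennreal A * emeasure \<mu> (ball x r)" if "0 < r" for x r
    proof -
      have "emeasure \<mu> (ball x s) = ennreal (measure \<mu> (ball x s))" if "0 < s" for s
        using balls[OF that, of x] by (simp add: emeasure_eq_ennreal_measure less_top)
      then show ?thesis using A that by (simp add: ennreal_mult[symmetric] ennreal_leI)
    qed
    show "sets borel \<subseteq> sets \<mu>"
      using reg unfolding regular_borel_measure_def by (rule conjunct1)
    show "\<exists>G\<in>sets borel. S \<subseteq> G \<and> emeasure \<mu> G = emeasure \<mu> S" if "S \<in> sets \<mu>" for S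
      using reg that unfolding regular_borel_measure_def by (elim conjE bspec)
  qed (use balls A(1) in simp_all)
  then show thesis by (rule that)
qed

theorem lemma3p1:
  fixes \<mu> :: "'a::metric_space measure" and \<rho> :: "'a \<Rightarrow> real" and q :: real
  assumes "rd_space \<mu>" and "admissible \<rho>" and "1 \<le> q"
  shows "BMO \<mu> \<rho> 1 = BMO \<mu> \<rho> q \<and>
    (\<exists>c C. 0 < c \<and> 0 < C \<and>
       (\<forall>f \<in> BMO \<mu> \<rho> 1.
          ennreal c * bmo_norm \<mu> \<rho> 1 f \<le> bmo_norm \<mu> \<rho> q f \<and>
          bmo_norm \<mu> \<rho> q f \<le> ennreal C * bmo_norm \<mu> \<rho> 1 f))"
proof -
  obtain A where "doubling_measure \<mu> A" using rd_space_imp_doubling_measure[OF assms(1)] .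
  then interpret doubling_measure \<mu> A .
  have Lq: "f \<in> Lq_loc \<mu> q" if "f \<in> BMO \<mu> \<rho> 1" for f
    using BMO_1_powr_bounds(1)[OF that \<open>1 \<le> q\<close>, of "2 * enn2real (bmo_norm \<mu> \<rho> 1 f) + 1"] by simp
  have "BMO \<mu> \<rho> 1 = BMO \<mu> \<rho> q"
  proof (intro equalityI subsetI)
    fix f assume f: "f \<in> BMO \<mu> \<rho> 1"
    have "bmo_norm \<mu> \<rho> q f \<le> ennreal (4 * bmo_const q) * bmo_norm \<mu> \<rho> 1 f"
      by (rule bmo_norm_le_bmo_norm_1[OF f \<open>1 \<le> q\<close>])
    also have "\<dots> < \<infinity>" using f by (simp add: BMO_def ennreal_mult_less_top)
    finally show "f \<in> BMO \<mu> \<rho> q" using Lq[OF f] by (simp add: BMO_def)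
  next
    fix f assume f: "f \<in> BMO \<mu> \<rho> q"
    then have "f \<in> Lq_loc \<mu> q" "bmo_norm \<mu> \<rho> q f < \<infinity>" by (auto simp: BMO_def)
    then show "f \<in> BMO \<mu> \<rho> 1"
      using Lq_loc_subset_L1_loc bmo_norm_1_le[of f q \<rho>] \<open>1 \<le> q\<close> by (auto simp: BMO_def intro: le_less_trans)
  qed
  moreover have "0 < 4 * bmo_const q" using bmo_const_pos by simp
  moreover have "\<forall>f \<in> BMO \<mu> \<rho> 1. ennreal 1 * bmo_norm \<mu> \<rho> 1 f \<le> bmo_norm \<mu> \<rho> q f \<and>
      bmo_norm \<mu> \<rho> q f \<le> ennreal (4 * bmo_const q) * bmo_norm \<mu> \<rho> 1 f"
    using bmo_norm_1_le[OF Lq \<open>1 \<le> q\<close>] bmo_norm_le_bmo_norm_1[OF _ \<open>1 \<le> q\<close>] by simp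
  ultimately show ?thesis using zero_less_one by (intro conjI exI)
qed

end
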